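(* For every finite set $X$ define $L:\mathbb T_X\to\mathbb{SC}_X$ by $L(\mathcal T)=\sum_{C\in\mathcal L_{\mathcal T}}C$. Then $L$ is a surjective morphism of bialgebras in the category of coalgebra species, that is: (1) for all finite sets $X,Y$ (disjoint), $\mathcal T\in\mathbb T_X$, $\mathcal T'\in\mathbb T_Y$: $L(\mathcal T\mathcal T')=L(\mathcal T)L(\mathcal T')$; (2) for every finite set $X$ and $\mathcal T\in\mathbb T_X$: $\Delta\circ L(\mathcal T)=(L\otimes L)\circ\Delta(\mathcal T)$; (3) for every finite set $X$ and $\mathcal T\in\mathbb T_X$: $\rho\circ L(\mathcal T)=(L\otimes L)\circ\Gamma(\mathcal T)$; and each $L:\mathbb T_X\to\mathbb{SC}_X$ is surjective.
   Context: Topologies: for a finite set $X$, $\mathbb T_X$ is the vector space freely generated by topologies on $X$. For a topology $\mathcal T$, $x\le_{\mathcal T}y$ iff every open set containing $x$ contains $y$ (open sets = final segments); $x\sim_{\mathcal T}y$ iff $x\le_{\mathcal T}y\le_{\mathcal T}x$; $x<_{\mathcal T}y$ iff $x\le_{\mathcal T}y$ and not $y\le_{\mathcal T}x$; $\mathcal T|_Y=\{Z\cap Y:Z\in\mathcal T\}$; $Y$ is $\mathcal T$-connected if $(Y,\mathcal T|_Y)$ is connected. Product $\mathcal T\mathcal T'$ on $X\sqcup Y$: $Z$ open iff $Z\cap X\in\mathcal T$ and $Z\cap Y\in\mathcal T'$. $\Delta(\mathcal T)=\sum_{Y\in\mathcal T}\mathcal T|_{X\setminus Y}\otimes\mathcal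 T|_Y$. $\mathcal T'\prec\mathcal T$ means every $\mathcal T$-open is $\mathcal T'$-open; for such, $\mathcal T/\mathcal T'$ is the topology on $X$ whose quasi-order is the transitive closure of $x\,\mathcal R\,y\iff(x\le_{\mathcal T}y\text{ or }y\le_{\mathcal T'}x)$; $\mathcal T'$ is $\mathcal T$-admissible if $\mathcal T'\prec\mathcal T$, $\mathcal T'|_Y=\mathcal T|_Y$ for all $\mathcal T'$-connected $Y$, and $x\sim_{\mathcal T/\mathcal T'}y\iff x\sim_{\mathcal T'/\mathcal T'}y$. $\Gamma(\mathcal T)=\sum_{\mathcal T'\ \mathcal T\text{-admissible}}\mathcal T'\otimes\mathcal T/\mathcal T'$. Set compositions: a set composition of $X$ is a sequence $(X_1,\dots,X_k)$ of nonempty sets with $X=X_1\sqcup\dots\sqcup X_k$; $\mathbb{SC}_X$ is the vector space they span. For $Y\subseteq X$ and $C=(X_1,\dots,X_k)$, let $\{i:X_i\cap Y\ne\emptyset\}=\{m_1<\dots<m_l\}$ and $C|_Y=(X_{m_1}\cap Y,\dots,X_{m_l}\cap Y)$. Product: for disjoint $X,Y$, $C'\in\mathbb{SC}_X$, $C''\in\mathbb{SC}_Y$, $C'C''=\sum C$ over set compositions $C$ of $X\sqcup Y$ with $C|_X=C'$ and $C|_Y=C''$. Coproduct $\Delta:\mathbb{SC}_X\to\bigoplus_{Y\subseteq X}\mathbb{SC}_{X\setminus Y}\otimes\mathbb{SC}_Y$, $\Delta(X_1,\dots,X_k)=\sum_{i=0}^k(X_1,\dots,X_i)\otimes(X_{i+1},\dots,X_k)$.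 Internal coproduct $\rho:\mathbb{SC}_X\to\mathbb{SC}_X\otimes\mathbb{SC}_X$: $\rho((X_1,\dots,X_k))=\sum_{i_1+\dots+i_p=k,\ i_j\ge1}(X_1,\dots,X_{i_1})\cdots(X_{i_1+\dots+i_{p-1}+1},\dots,X_k)\otimes(X_1\sqcup\dots\sqcup X_{i_1},\dots,X_{i_1+\dots+i_{p-1}+1}\sqcup\dots\sqcup X_k)$, the first factor being the product of set compositions of the disjoint blocks. Linear extensions: $C=(X_1,\dots,X_k)\in\mathbb{SC}_X$ is a linear extension of $\mathcal T$ if for $x\in X_i,y\in X_j$: $x<_{\mathcal T}y\Rightarrow i<j$ and $x\sim_{\mathcal T}y\Rightarrow i=j$. $\mathcal L_{\mathcal T}$ is the set of linear extensions of $\mathcal T$. *)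

theory Defs
  imports "HOL-Analysis.Analysis" "HOL-Library.Poly_Mapping" "HOL-Library.Disjoint_Sets"
begin

section \<open>Free vector spaces\<close>

text \<open>
  The vector space over a field \<open>'k\<close> freely generated by a set \<open>B\<close> consists of the finitely
  supported functions with support in \<open>B\<close>. The tensor product of the spaces freely generated by
  \<open>A\<close> and \<open>B\<close> is the space freely generated by \<open>A \<times> B\<close>.
\<close>

definition free_space :: "'b set \<Rightarrow> ('b \<Rightarrow>\<^sub>0 'k::field) set" where
  "free_space B = {v. Poly_Mapping.keys v \<subseteq> B}"

abbreviation basis :: "'b \<Rightarrow> ('b \<Rightarrow>\<^sub>0 'k::field)" where
  "basis b \<equiv> Poly_Mapping.single b 1"

definition scale :: "'k::field \<Rightarrow> ('b \<Rightarrow>\<^sub>0 'k) \<Rightarrow> ('b \<Rightarrow>\<^sub>0 'k)" where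
  "scale c v = Poly_Mapping.map ((*) c) v"

definition lin_ext :: "('b \<Rightarrow> ('c \<Rightarrow>\<^sub>0 'k::field)) \<Rightarrow> ('b \<Rightarrow>\<^sub>0 'k) \<Rightarrow> ('c \<Rightarrow>\<^sub>0 'k)" where
  "lin_ext f v = (\<Sum>b\<in>Poly_Mapping.keys v. scale (Poly_Mapping.lookup v b) (f b))"

definition tensor :: "('b \<Rightarrow>\<^sub>0 'k::field) \<Rightarrow> ('c \<Rightarrow>\<^sub>0 'k) \<Rightarrow> ('b \<times> 'c \<Rightarrow>\<^sub>0 'k)" (infixr "\<otimes>\<^sub>v" 70) where
  "u \<otimes>\<^sub>v v = (\<Sum>b\<in>Poly_Mapping.keys u. \<Sum>c\<in>Poly_Mapping.keys v.
     Poly_Mapping.single (b, c) (Poly_Mapping.lookup u b * Poly_Mapping.lookup v c))"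

definition tensor_map ::
    "(('b \<Rightarrow>\<^sub>0 'k::field) \<Rightarrow> ('d \<Rightarrow>\<^sub>0 'k)) \<Rightarrow> (('c \<Rightarrow>\<^sub>0 'k) \<Rightarrow> ('e \<Rightarrow>\<^sub>0 'k)) \<Rightarrow>
     ('b \<times> 'c \<Rightarrow>\<^sub>0 'k) \<Rightarrow> ('d \<times> 'e \<Rightarrow>\<^sub>0 'k)" where
  "tensor_map f g = lin_ext (\<lambda>(b, c). f (basis b) \<otimes>\<^sub>v g (basis c))"

lemma lookup_scale [simp]: "Poly_Mapping.lookup (scale c v) b = c * Poly_Mapping.lookup v b"
  unfolding scale_def by (transfer) (auto simp: when_def)

lemma vector_space_scale: "vector_space scale"
  by unfold_locales (auto intro!: poly_mapping_eqI simp: lookup_add algebra_simps)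

lemma lin_ext_superset:
  assumes "finite S" "Poly_Mapping.keys v \<subseteq> S"
  shows "lin_ext f v = (\<Sum>b\<in>S. scale (Poly_Mapping.lookup v b) (f b))"
  unfolding lin_ext_def
  by (rule sum.mono_neutral_left[OF assms])
     (auto simp: in_keys_iff intro!: poly_mapping_eqI)

lemma lin_ext_linear: "Vector_Spaces.linear scale scale (lin_ext f)"
proof -
  interpret vector_space scale by (rule vector_space_scale)
  have add: "lin_ext f (u + v) = lin_ext f u + lin_ext f v" for u v
  proof -
    let ?S = "Poly_Mapping.keys u \<union> Poly_Mapping.keys v"
    have S: "finite ?S" by simp
    have "lin_ext f (u + v) = (\<Sum>b\<in>?S. scale (Poly_Mapping.lookup (u + v) b) (f b))"
      by (rule lin_ext_superset[OF S Poly_Mapping.keys_add])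
    also have "\<dots> = lin_ext f u + lin_ext f v"
      by (simp add: lin_ext_superset[OF S, of u] lin_ext_superset[OF S, of v]
          lookup_add scale_left_distrib sum.distrib)
    finally show ?thesis .
  qed
  have "lin_ext f (scale c v) = scale c (lin_ext f v)" for c v
  proof -
    have "Poly_Mapping.keys (scale c v) \<subseteq> Poly_Mapping.keys v"
      by (auto simp: in_keys_iff)
    from lin_ext_superset[OF finite_keys this] show ?thesis
      by (simp add: lin_ext_def scale_sum_right)
  qed
  with add show ?thesis
    by (auto intro!: Vector_Spaces.linear.intro module_hom.intro module_hom_axioms.intro
        vector_space_scale simp: module_iff_vector_space)
qed

lemma lin_ext_basis [simp]: "lin_ext f (basis b) = f b"
  by (auto simp: lin_ext_def intro!: poly_mapping_eqI)

section \<open>Topologies on finite sets\<close>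

definition topologies_on :: "'a set \<Rightarrow> 'a topology set" where
  "topologies_on X = {T. topspace T = X}"

abbreviation T_space :: "'a set \<Rightarrow> ('a topology \<Rightarrow>\<^sub>0 'k::field) set" where
  "T_space X \<equiv> free_space (topologies_on X)"

definition top_le :: "'a topology \<Rightarrow> 'a \<Rightarrow> 'a \<Rightarrow> bool" where
  "top_le T x y \<longleftrightarrow> x \<in> topspace T \<and> y \<in> topspace T \<and> (\<forall>U. openin T U \<longrightarrow> x \<in> U \<longrightarrow> y \<in> U)"

definition top_sim :: "'a topology \<Rightarrow> 'a \<Rightarrow> 'a \<Rightarrow> bool" where
  "top_sim T x y \<longleftrightarrow> top_le T x y \<and> top_le T y x"

definition top_less :: "'a topology \<Rightarrow> 'a \<Rightarrow> 'a \<Rightarrow> bool" where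
  "top_less T x y \<longleftrightarrow> top_le T x y \<and> \<not> top_le T y x"

definition top_prod :: "'a topology \<Rightarrow> 'a topology \<Rightarrow> 'a topology" where
  "top_prod T T' = topology (\<lambda>Z. Z \<subseteq> topspace T \<union> topspace T' \<and>
     openin T (Z \<inter> topspace T) \<and> openin T' (Z \<inter> topspace T'))"

lemma openin_top_prod:
  "openin (top_prod T T') Z \<longleftrightarrow> Z \<subseteq> topspace T \<union> topspace T' \<and>
     openin T (Z \<inter> topspace T) \<and> openin T' (Z \<inter> topspace T')"
proof -
  have "istopology (\<lambda>Z. Z \<subseteq> topspace T \<union> topspace T' \<and>
     openin T (Z \<inter> topspace T) \<and> openin T' (Z \<inter> topspace T'))"
    unfolding istopology_def
  proof (intro conjI allI impI; (elim conjE)?)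
    fix A B :: "'a set"
    assume "openin T (A \<inter> topspace T)" "openin T (B \<inter> topspace T)"
    from openin_Int[OF this] show "openin T (A \<inter> B \<inter> topspace T)"
      by (simp add: Int_ac)
  next
    fix A B :: "'a set"
    assume "openin T' (A \<inter> topspace T')" "openin T' (B \<inter> topspace T')"
    from openin_Int[OF this] show "openin T' (A \<inter> B \<inter> topspace T')"
      by (simp add: Int_ac)
  next
    fix \<K> :: "'a set set"
    assume *: "\<forall>K\<in>\<K>. K \<subseteq> topspace T \<union> topspace T' \<and> openin T (K \<inter> topspace T) \<and>
      openin T' (K \<inter> topspace T')"
    show "openin T (\<Union>\<K> \<inter> topspace T)" "openin T' (\<Union>\<K> \<inter> topspace T')"
      unfolding Int_Union2 by (rule openin_Union; use * in blast)+
  qed auto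
  then show ?thesis
    by (simp add: top_prod_def topology_inverse')
qed

definition T_mult :: "('a topology \<Rightarrow>\<^sub>0 'k::field) \<Rightarrow> ('a topology \<Rightarrow>\<^sub>0 'k) \<Rightarrow> ('a topology \<Rightarrow>\<^sub>0 'k)" where
  "T_mult s t = lin_ext (\<lambda>(T, T'). basis (top_prod T T')) (s \<otimes>\<^sub>v t)"

text \<open>
  The direct sum over all \<open>Y \<subseteq> X\<close> is realised inside the space generated by all pairs: the index
  \<open>Y\<close> is recovered from a pair as the underlying set of its second component.
\<close>

definition T_Delta :: "('a topology \<Rightarrow>\<^sub>0 'k::field) \<Rightarrow> ('a topology \<times> 'a topology \<Rightarrow>\<^sub>0 'k)" where
  "T_Delta = lin_ext (\<lambda>T. \<Sum>Y | openin T Y.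
     basis (subtopology T (topspace T - Y), subtopology T Y))"

definition finer :: "'a topology \<Rightarrow> 'a topology \<Rightarrow> bool" (infix "\<prec>\<^sub>T" 50) where
  "T' \<prec>\<^sub>T T \<longleftrightarrow> topspace T' = topspace T \<and> (\<forall>U. openin T U \<longrightarrow> openin T' U)"

definition top_of_order :: "'a set \<Rightarrow> ('a \<Rightarrow> 'a \<Rightarrow> bool) \<Rightarrow> 'a topology" where
  "top_of_order X r = topology (\<lambda>U. U \<subseteq> X \<and> (\<forall>x\<in>U. \<forall>y\<in>X. r x y \<longrightarrow> y \<in> U))"

definition top_quot :: "'a topology \<Rightarrow> 'a topology \<Rightarrow> 'a topology" (infixl "'/\<^sub>T" 70) where
  "T /\<^sub>T T' = top_of_order (topspace T) (\<lambda>x y. top_le T x y \<or> top_le T' y x)\<^sup>+\<^sup>+"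

lemma openin_top_of_order:
  "openin (top_of_order X r) U \<longleftrightarrow> U \<subseteq> X \<and> (\<forall>x\<in>U. \<forall>y\<in>X. r x y \<longrightarrow> y \<in> U)"
proof -
  have "istopology (\<lambda>U. U \<subseteq> X \<and> (\<forall>x\<in>U. \<forall>y\<in>X. r x y \<longrightarrow> y \<in> U))"
    unfolding istopology_def by blast
  then show ?thesis
    by (simp add: top_of_order_def topology_inverse')
qed

lemma topspace_top_of_order [simp]: "topspace (top_of_order X r) = X"
  by (rule antisym) (auto simp: topspace_def openin_top_of_order)

lemma top_le_top_of_order:
  assumes "\<And>x. x \<in> X \<Longrightarrow> r x x" "\<And>x y z. r x y \<Longrightarrow> r y z \<Longrightarrow> r x z"
  shows "top_le (top_of_order X r) x y \<longleftrightarrow> x \<in> X \<and> y \<in> X \<and> r x y"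
proof
  assume *: "top_le (top_of_order X r) x y"
  have "openin (top_of_order X r) {z\<in>X. r x z}"
    unfolding openin_top_of_order using assms(2) by blast
  with * show "x \<in> X \<and> y \<in> X \<and> r x y"
    using assms(1) by (auto simp: top_le_def)
qed (auto simp: top_le_def openin_top_of_order)

lemma top_le_top_quot:
  assumes "T' \<prec>\<^sub>T T"
  shows "top_le (T /\<^sub>T T') = (\<lambda>x y. top_le T x y \<or> top_le T' y x)\<^sup>+\<^sup>+"
proof (intro ext)
  fix x y
  let ?R = "\<lambda>x y. top_le T x y \<or> top_le T' y x"
  have "x \<in> topspace T \<and> y \<in> topspace T" if "?R\<^sup>+\<^sup>+ x y"
    using that by (induction) (use assms in \<open>auto simp: finer_def top_le_def\<close>)
  moreover have "?R\<^sup>+\<^sup>+ z z" if "z \<in> topspace T" for z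
    using that by (auto simp: top_le_def)
  ultimately show "top_le (T /\<^sub>T T') x y = ?R\<^sup>+\<^sup>+ x y"
    unfolding top_quot_def
    by (subst top_le_top_of_order) (auto intro: tranclp_trans)
qed

definition admissible :: "'a topology \<Rightarrow> 'a topology \<Rightarrow> bool" where
  "admissible T T' \<longleftrightarrow> T' \<prec>\<^sub>T T \<and>
     (\<forall>Y. connectedin T' Y \<longrightarrow> subtopology T' Y = subtopology T Y) \<and>
     (\<forall>x\<in>topspace T. \<forall>y\<in>topspace T. top_sim (T /\<^sub>T T') x y \<longleftrightarrow> top_sim (T' /\<^sub>T T') x y)"

definition T_Gamma :: "('a topology \<Rightarrow>\<^sub>0 'k::field) \<Rightarrow> ('a topology \<times> 'a topology \<Rightarrow>\<^sub>0 'k)" where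
  "T_Gamma = lin_ext (\<lambda>T. \<Sum>T' | admissible T T'. basis (T', T /\<^sub>T T'))"

section \<open>Set compositions\<close>

definition set_compositions :: "'a set \<Rightarrow> 'a set list set" where
  "set_compositions X = {C. distinct C \<and> partition_on X (set C)}"

abbreviation SC_space :: "'a set \<Rightarrow> ('a set list \<Rightarrow>\<^sub>0 'k::field) set" where
  "SC_space X \<equiv> free_space (set_compositions X)"

definition sc_restrict :: "'a set list \<Rightarrow> 'a set \<Rightarrow> 'a set list" where
  "sc_restrict C Y = filter (\<lambda>B. B \<noteq> {}) (map (\<lambda>B. B \<inter> Y) C)"

definition sc_prod :: "'a set list \<Rightarrow> 'a set list \<Rightarrow> ('a set list \<Rightarrow>\<^sub>0 'k::field)" where
  "sc_prod C' C'' = (let X = \<Union>(set C'); Y = \<Union>(set C'') in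
     \<Sum>C | C \<in> set_compositions (X \<union> Y) \<and> sc_restrict C X = C' \<and> sc_restrict C Y = C''. basis C)"

definition SC_mult :: "('a set list \<Rightarrow>\<^sub>0 'k::field) \<Rightarrow> ('a set list \<Rightarrow>\<^sub>0 'k) \<Rightarrow> ('a set list \<Rightarrow>\<^sub>0 'k)" where
  "SC_mult u v = lin_ext (\<lambda>(C', C''). sc_prod C' C'') (u \<otimes>\<^sub>v v)"

definition SC_Delta :: "('a set list \<Rightarrow>\<^sub>0 'k::field) \<Rightarrow> ('a set list \<times> 'a set list \<Rightarrow>\<^sub>0 'k)" where
  "SC_Delta = lin_ext (\<lambda>C. \<Sum>i\<le>length C. basis (take i C, drop i C))"

text \<open>\<open>chop [i\<^sub>1, \<dots>, i\<^sub>p] xs\<close> cuts \<open>xs\<close> into consecutive pieces of lengths \<open>i\<^sub>1, \<dots>, i\<^sub>p\<close>.\<close>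

fun chop :: "nat list \<Rightarrow> 'b list \<Rightarrow> 'b list list" where
  "chop [] xs = []"
| "chop (i # is) xs = take i xs # chop is (drop i xs)"

definition SC_prod_list :: "'a set list list \<Rightarrow> ('a set list \<Rightarrow>\<^sub>0 'k::field)" where
  "SC_prod_list Cs = foldr SC_mult (map basis Cs) (basis [])"

definition SC_rho :: "('a set list \<Rightarrow>\<^sub>0 'k::field) \<Rightarrow> ('a set list \<times> 'a set list \<Rightarrow>\<^sub>0 'k)" where
  "SC_rho = lin_ext (\<lambda>C. \<Sum>is | sum_list is = length C \<and> (\<forall>i\<in>set is. 1 \<le> i).
     SC_prod_list (chop is C) \<otimes>\<^sub>v basis (map (\<lambda>D. \<Union>(set D)) (chop is C)))"

section \<open>Linear extensions\<close>

definition linear_extensions :: "'a topology \<Rightarrow> 'a set list set" where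
  "linear_extensions T = {C \<in> set_compositions (topspace T).
     \<forall>i<length C. \<forall>j<length C. \<forall>x\<in>C ! i. \<forall>y\<in>C ! j.
       (top_less T x y \<longrightarrow> i < j) \<and> (top_sim T x y \<longrightarrow> i = j)}"

definition L_map :: "('a topology \<Rightarrow>\<^sub>0 'k::field) \<Rightarrow> ('a set list \<Rightarrow>\<^sub>0 'k)" where
  "L_map = lin_ext (\<lambda>T. \<Sum>C\<in>linear_extensions T. basis C)"

end

theory Submission
  imports Defs
begin

text \<open>
  A set composition \<open>C\<close> is the same as a total preorder \<open>sc_le C\<close>, and \<open>C\<close> is a linear extension of
  \<open>T\<close> iff \<open>x \<le>\<^sub>T y\<close> implies \<open>sc_le C x y\<close>, where \<open>sc_le C y x\<close> moreover forces \<open>y \<le>\<^sub>T x\<close>.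
  Every identity then becomes a bijection of index sets.

  For the internal coproduct, both sides are multiplicity-free sums over the pairs \<open>(A, B)\<close> of set
  compositions such that the refinement of \<open>B\<close> by \<open>A\<close>, that is the concatenation of the restrictions
  of \<open>A\<close> to the successive blocks of \<open>B\<close>, is a linear extension of \<open>T\<close>. On the topological side the
  admissible \<open>T'\<close> is determined by \<open>B\<close>: its order is that of \<open>T\<close> restricted to pairs in a common block
  of \<open>B\<close>. Surjectivity holds because the topology of the preorder \<open>sc_le C\<close> has \<open>C\<close> as its only
  linear extension.
\<close>

section \<open>Linear maps on free vector spaces\<close>

lemma linear_sum_scale:
  assumes "Vector_Spaces.linear scale scale f"
  shows "f (\<Sum>i\<in>I. scale (c i) (v i)) = (\<Sum>i\<in>I. scale (c i) (f (v i)))"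
proof -
  interpret Vector_Spaces.linear scale scale f by fact
  show ?thesis by (simp add: sum scale)
qed

lemma basis_expansion: "v = (\<Sum>b\<in>Poly_Mapping.keys v. scale (Poly_Mapping.lookup v b) (basis b))"
  by (rule poly_mapping_eqI)
     (auto simp: lookup_sum lookup_single when_def in_keys_iff if_distrib[of "\<lambda>x. _ * x"] cong: if_cong)

text \<open>Expanding \<open>v\<close> in basis vectors leaves only those indexed by
  \<open>B\<close>. Each identity of the theorem is thereby reduced to single topologies.\<close>

lemma linear_eq_on_free_space:
  assumes "Vector_Spaces.linear scale scale f" "Vector_Spaces.linear scale scale g"
    and "\<And>b. b \<in> B \<Longrightarrow> f (basis b) = g (basis b)" and "v \<in> free_space B"
  shows "f v = g v"
proof -
  have "f (\<Sum>b\<in>Poly_Mapping.keys v. scale (Poly_Mapping.lookup v b) (basis b)) =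
        g (\<Sum>b\<in>Poly_Mapping.keys v. scale (Poly_Mapping.lookup v b) (basis b))"
    unfolding assms(1,2)[THEN linear_sum_scale]
    by (rule sum.cong) (use assms(3,4) in \<open>auto simp: free_space_def\<close>)
  then show ?thesis
    by (simp flip: basis_expansion)
qed

lemma lin_ext_sum: "lin_ext f (\<Sum>i\<in>I. v i) = (\<Sum>i\<in>I. lin_ext f (v i))"
proof -
  interpret Vector_Spaces.linear scale scale "lin_ext f" by (rule lin_ext_linear)
  show ?thesis by (rule sum)
qed

lemma lin_ext_sum_basis: "lin_ext f (\<Sum>i\<in>I. basis (g i)) = (\<Sum>i\<in>I. f (g i))"
  by (simp add: lin_ext_sum)

text \<open>Coefficients outside the supports vanish, so the double sum collapses to a formula valid
  at every pair. Tensors can then be compared coefficient by coefficient.\<close>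

lemma lookup_tensor:
  "Poly_Mapping.lookup (u \<otimes>\<^sub>v v) (b, c) = Poly_Mapping.lookup u b * Poly_Mapping.lookup v c"
proof -
  have "Poly_Mapping.lookup (u \<otimes>\<^sub>v v) (b, c) =
    (\<Sum>b'\<in>Poly_Mapping.keys u. if b' = b then (\<Sum>c'\<in>Poly_Mapping.keys v. if c' = c
       then Poly_Mapping.lookup u b * Poly_Mapping.lookup v c else 0) else 0)"
    unfolding tensor_def lookup_sum by (intro sum.cong) (auto simp: lookup_single when_def intro!: sum.cong)
  then show ?thesis
    by (auto simp: in_keys_iff)
qed

lemma tensor_linear_left: "Vector_Spaces.linear scale scale (\<lambda>u. u \<otimes>\<^sub>v v)"
  by (auto intro!: Vector_Spaces.linear.intro module_hom.intro module_hom_axioms.intro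
      vector_space_scale poly_mapping_eqI
      simp: module_iff_vector_space lookup_tensor lookup_add algebra_simps)

lemma tensor_linear_right: "Vector_Spaces.linear scale scale (\<lambda>v. u \<otimes>\<^sub>v v)"
  by (auto intro!: Vector_Spaces.linear.intro module_hom.intro module_hom_axioms.intro
      vector_space_scale poly_mapping_eqI
      simp: module_iff_vector_space lookup_tensor lookup_add algebra_simps)

lemma tensor_sum_left: "(\<Sum>i\<in>I. u i) \<otimes>\<^sub>v v = (\<Sum>i\<in>I. u i \<otimes>\<^sub>v v)"
  by (rule poly_mapping_eqI) (auto simp: lookup_tensor lookup_sum sum_distrib_right)

lemma tensor_sum_right: "u \<otimes>\<^sub>v (\<Sum>i\<in>I. v i) = (\<Sum>i\<in>I. u \<otimes>\<^sub>v v i)"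
  by (rule poly_mapping_eqI) (auto simp: lookup_tensor lookup_sum sum_distrib_left)

lemma tensor_basis [simp]: "basis b \<otimes>\<^sub>v basis c = basis (b, c)"
  by (simp add: tensor_def)

lemma tensor_sum_basis:
  "(\<Sum>a\<in>A. basis a) \<otimes>\<^sub>v (\<Sum>b\<in>B. basis b) = (\<Sum>p\<in>A \<times> B. basis p)"
  unfolding tensor_sum_left unfolding tensor_sum_right
  by (simp add: sum.cartesian_product case_prod_unfold)

lemma linear_comp:
  assumes "Vector_Spaces.linear scale scale f" "Vector_Spaces.linear scale scale g"
  shows "Vector_Spaces.linear scale scale (\<lambda>v. f (g v))"
  using Vector_Spaces.linear_compose[OF assms(2,1)] by (simp add: o_def)

section \<open>Set compositions as total preorders\<close>

text \<open>Recursion on the list, rather than a comparison of block positions, makes inductions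
  direct; \<open>sc_le_iff_nth\<close> supplies the positional form that matches
  \<open>linear_extensions\<close>.\<close>

fun sc_le :: "'a set list \<Rightarrow> 'a \<Rightarrow> 'a \<Rightarrow> bool" where
  "sc_le [] x y \<longleftrightarrow> False"
| "sc_le (B # C) x y \<longleftrightarrow> x \<in> B \<and> y \<in> B \<union> \<Union>(set C) \<or> sc_le C x y"

lemma sc_Nil_iff [simp]: "[] \<in> set_compositions X \<longleftrightarrow> X = {}"
  by (auto simp: set_compositions_def partition_on_def)

text \<open>Peeling off the first block shrinks the ground set, which is why later inductions over a
  composition keep the ground set arbitrary.\<close>

lemma sc_Cons_iff:
  "B # C \<in> set_compositions X \<longleftrightarrow> B \<noteq> {} \<and> B \<subseteq> X \<and> C \<in> set_compositions (X - B)"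
proof
  assume "B # C \<in> set_compositions X"
  then show "B \<noteq> {} \<and> B \<subseteq> X \<and> C \<in> set_compositions (X - B)"
    by (auto simp: set_compositions_def partition_on_def disjoint_def)
next
  assume *: "B \<noteq> {} \<and> B \<subseteq> X \<and> C \<in> set_compositions (X - B)"
  then have "B \<notin> set C" "\<And>D. D \<in> set C \<Longrightarrow> B \<inter> D = {}"
    by (auto simp: set_compositions_def partition_on_def)
  with * show "B # C \<in> set_compositions X"
    by (auto simp: set_compositions_def partition_on_def disjoint_def)
qed

lemma Union_sc: "C \<in> set_compositions X \<Longrightarrow> \<Union>(set C) = X"
  by (auto simp: set_compositions_def partition_on_def)

lemma sc_append_iff:
  "C @ D \<in> set_compositions X \<longleftrightarrow> \<Union>(set C) \<subseteq> X \<and> C \<in> set_compositions (\<Union>(set C)) \<and>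
     D \<in> set_compositions (X - \<Union>(set C))"
proof (induction C arbitrary: X)
  case (Cons B C)
  \<comment> \<open>A composition determines its ground set as the union of its blocks, so the left
    side silently says that \<open>B\<close> is disjoint from the later blocks.\<close>
  have "C \<in> set_compositions (B \<union> \<Union>(set C) - B) \<longleftrightarrow>
    C \<in> set_compositions (\<Union>(set C)) \<and> B \<inter> \<Union>(set C) = {}"
    by (metis Diff_disjoint Diff_triv Un_Diff Union_sc Diff_cancel Un_empty_left inf_commute)
  moreover have "X - B - \<Union>(set C) = X - (B \<union> \<Union>(set C))"
    by blast
  ultimately show ?case
    unfolding append_Cons sc_Cons_iff Cons.IH by auto
qed simp

lemma finite_set_compositions: "finite X \<Longrightarrow> finite (set_compositions X)"
  by (rule finite_subset[OF _ finite_subset_distinct[of "Pow X"]])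
     (auto simp: set_compositions_def partition_on_def)

lemma sc_le_field: "sc_le C x y \<Longrightarrow> x \<in> \<Union>(set C) \<and> y \<in> \<Union>(set C)"
  by (induction C) auto

lemma sc_le_refl: "x \<in> \<Union>(set C) \<Longrightarrow> sc_le C x x"
  by (induction C) auto

lemma sc_le_total: "x \<in> \<Union>(set C) \<Longrightarrow> y \<in> \<Union>(set C) \<Longrightarrow> sc_le C x y \<or> sc_le C y x"
  by (induction C) auto

text \<open>This rests on disjointness: a point shared by two blocks could link a late position to
  an early one.\<close>

lemma sc_le_trans:
  assumes "C \<in> set_compositions X" "sc_le C x y" "sc_le C y z"
  shows "sc_le C x z"
  using assms
proof (induction C arbitrary: X)
  case (Cons B C)
  then show ?case
    using sc_le_field[of C] Union_sc[of C "X - B"] by (fastforce simp: sc_Cons_iff)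
qed simp

lemma sc_le_append:
  "sc_le (C @ D) x y \<longleftrightarrow> sc_le C x y \<or> x \<in> \<Union>(set C) \<and> y \<in> \<Union>(set D) \<or> sc_le D x y"
  by (induction C) auto

lemma sc_le_iff_nth:
  "sc_le C x y \<longleftrightarrow> (\<exists>i j. i \<le> j \<and> j < length C \<and> x \<in> C ! i \<and> y \<in> C ! j)"
proof (induction C)
  case (Cons B C)
  show ?case
  proof
    assume "sc_le (B # C) x y"
    then consider "x \<in> B" "y \<in> \<Union>(set (B # C))" | "sc_le C x y"
      by auto
    then show "\<exists>i j. i \<le> j \<and> j < length (B # C) \<and> x \<in> (B # C) ! i \<and> y \<in> (B # C) ! j"
    proof cases
      case 1
      then obtain j where "j < length (B # C)" "y \<in> (B # C) ! j"
        by (metis UnionE in_set_conv_nth)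
      with 1 show ?thesis
        by (intro exI[of _ 0] exI[of _ j]) auto
    next
      case 2
      then obtain i j where "i \<le> j" "j < length C" "x \<in> C ! i" "y \<in> C ! j"
        using Cons.IH by blast
      then show ?thesis
        by (intro exI[of _ "Suc i"] exI[of _ "Suc j"]) auto
    qed
  next
    assume "\<exists>i j. i \<le> j \<and> j < length (B # C) \<and> x \<in> (B # C) ! i \<and> y \<in> (B # C) ! j"
    then obtain i j where ij: "i \<le> j" "j < length (B # C)" "x \<in> (B # C) ! i" "y \<in> (B # C) ! j"
      by blast
    then have "y \<in> \<Union>(set (B # C))"
      using nth_mem by blast
    with ij Cons.IH show "sc_le (B # C) x y"
      by (cases i; cases j) auto
  qed
qed simp

lemma sc_nth_unique:
  assumes "C \<in> set_compositions X" "i < length C" "j < length C" "x \<in> C ! i" "x \<in> C ! j"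
  shows "i = j"
proof -
  have "C ! i = C ! j"
    using assms(1) nth_mem[OF assms(2)] nth_mem[OF assms(3)] assms(4,5)
    unfolding set_compositions_def partition_on_def disjoint_def by blast
  with assms show ?thesis
    by (auto simp: set_compositions_def nth_eq_iff_index_eq)
qed

text \<open>The first block is nonempty, and only its own points lie below a chosen point
  \<open>b\<close> of it.\<close>

lemma sc_hd_eq_minimal:
  assumes "B # C \<in> set_compositions X"
  shows "B = {x \<in> X. \<forall>y\<in>X. sc_le (B # C) x y}"
proof -
  have B: "\<Union>(set C) = X - B" "B \<noteq> {}" "B \<subseteq> X"
    using assms Union_sc[of C] by (auto simp: sc_Cons_iff)
  then obtain b where b: "b \<in> B" by blast
  have "sc_le (B # C) x y" if "x \<in> B" "y \<in> X" for x y
    using that B(1) by simp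
  moreover have "x \<in> B" if "sc_le (B # C) x b" for x
    using that b sc_le_field[of C x b] B(1) by auto
  ultimately show ?thesis
    using b B(3) by blast
qed

text \<open>The first block is the set of least elements, and the tail induces the same preorder on
  the complement, so the blocks are recovered one after another.\<close>

lemma sc_eqI:
  assumes "C \<in> set_compositions X" "D \<in> set_compositions X"
    and "\<And>x y. sc_le C x y \<longleftrightarrow> sc_le D x y"
  shows "C = D"
  using assms
proof (induction C arbitrary: D X)
  case Nil
  then show ?case
    by (cases D) (auto simp: sc_Cons_iff)
next
  case (Cons B C)
  then obtain E D' where D: "D = E # D'"
    by (cases D) (auto simp: sc_Cons_iff)
  have B: "B = E"
    using sc_hd_eq_minimal[OF Cons.prems(1)] sc_hd_eq_minimal[of E D' X] Cons.prems(2,3)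
    unfolding D by simp
  \<comment> \<open>This passes the agreement of the two preorders on to the tails.\<close>
  have *: "sc_le F x y \<longleftrightarrow> sc_le (B # F) x y \<and> x \<notin> B" if "F \<in> set_compositions (X - B)" for F x y
    using Union_sc[OF that] sc_le_field[of F x y] by auto
  have C: "C \<in> set_compositions (X - B)" and D': "D' \<in> set_compositions (X - B)"
    using Cons.prems(1,2) by (auto simp: sc_Cons_iff D B)
  have "C = D'"
    by (rule Cons.IH[OF C D'])
       (use *[OF C] *[OF D'] Cons.prems(3) in \<open>simp add: D B\<close>)
  with B D show ?case by simp
qed

section \<open>Restriction of set compositions and refinement of one by another\<close>

lemma sc_restrict_Nil [simp]: "sc_restrict [] Y = []"
  by (simp add: sc_restrict_def)

lemma sc_restrict_Cons:
  "sc_restrict (B # C) Y = (if B \<inter> Y = {} then sc_restrict C Y else (B \<inter> Y) # sc_restrict C Y)"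
  by (simp add: sc_restrict_def)

lemma Union_sc_restrict [simp]: "\<Union>(set (sc_restrict C Y)) = \<Union>(set C) \<inter> Y"
  by (induction C) (auto simp: sc_restrict_Cons)

lemma sc_restrict_restrict: "sc_restrict (sc_restrict C Y) Z = sc_restrict C (Y \<inter> Z)"
  by (induction C) (auto simp: sc_restrict_Cons Int_assoc)

lemma sc_restrict_in_sc:
  "C \<in> set_compositions X \<Longrightarrow> sc_restrict C Y \<in> set_compositions (X \<inter> Y)"
proof (induction C arbitrary: X)
  case (Cons B C)
  from Cons.prems have C: "B \<subseteq> X" "C \<in> set_compositions (X - B)"
    by (auto simp: sc_Cons_iff)
  have "X \<inter> Y - B \<inter> Y = (X - B) \<inter> Y" by blast
  moreover have "X \<inter> Y = (X - B) \<inter> Y" if "B \<inter> Y = {}" using that by blast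
  ultimately show ?case
    using Cons.IH[OF C(2)] C(1) by (auto simp: sc_restrict_Cons sc_Cons_iff)
qed simp

lemma sc_le_restrict: "sc_le (sc_restrict C Y) x y \<longleftrightarrow> x \<in> Y \<and> y \<in> Y \<and> sc_le C x y"
  by (induction C) (auto simp: sc_restrict_Cons)

text \<open>Cutting a composition into nonempty pieces amounts to choosing a coarser composition
  together with a composition of each of its blocks. An empty piece would have an empty union, which
  is no block.\<close>

lemma concat_in_sc_iff:
  "concat Ds \<in> set_compositions X \<and> [] \<notin> set Ds \<longleftrightarrow>
     map (\<lambda>D. \<Union>(set D)) Ds \<in> set_compositions X \<and> (\<forall>D\<in>set Ds. D \<in> set_compositions (\<Union>(set D)))"
proof (induction Ds arbitrary: X)
  case (Cons D Ds)
  have "\<Union>(set D) \<noteq> {} \<longleftrightarrow> D \<noteq> []" if "D \<in> set_compositions (\<Union>(set D))"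
    using that by (cases D) (auto simp: sc_Cons_iff)
  then show ?case
    using Cons.IH[of "X - \<Union>(set D)"] by (auto simp: sc_append_iff sc_Cons_iff)
qed simp

text \<open>The refinement is a lexicographic order: \<open>B\<close> compares points of different
  blocks, and \<open>A\<close> decides inside a block.\<close>

lemma sc_le_concat_restrict:
  assumes "B \<in> set_compositions Z" "Z \<subseteq> \<Union>(set A)"
  shows "sc_le (concat (map (sc_restrict A) B)) x y \<longleftrightarrow>
    sc_le B x y \<and> (sc_le B y x \<longrightarrow> sc_le A x y)"
  using assms
proof (induction B arbitrary: Z)
  case (Cons E B)
  have B: "B \<in> set_compositions (Z - E)" "E \<subseteq> Z" "Z - E \<subseteq> \<Union>(set A)"
    using Cons.prems by (auto simp: sc_Cons_iff)
  have U: "\<Union>(set B) = Z - E"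
    by (rule Union_sc[OF B(1)])
  have UC: "\<Union>(set (concat (map (sc_restrict A) B))) = \<Union>(set A) \<inter> \<Union>(set B)"
    by (induction B) auto
  have "sc_le B x y \<Longrightarrow> x \<in> Z - E \<and> y \<in> Z - E" "sc_le B y x \<Longrightarrow> x \<in> Z - E \<and> y \<in> Z - E"
    using sc_le_field[of B] U by blast+
  then show ?case
    using Cons.IH[OF B(1,3)] B Cons.prems(2) U
    unfolding concat.simps list.map sc_le_append UC sc_le_restrict Union_sc_restrict sc_le.simps
    by blast
qed simp

text \<open>Each piece is a composition of a whole block of \<open>B\<close>, so \<open>B\<close>
  can be read off from the pieces. This makes the pair \<open>(A, B)\<close> recoverable when sums
  are reindexed.\<close>

lemma concat_restrict_in_sc:
  assumes "A \<in> set_compositions X" "B \<in> set_compositions X"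
  shows "concat (map (sc_restrict A) B) \<in> set_compositions X" "[] \<notin> set (map (sc_restrict A) B)"
    "map (\<lambda>D. \<Union>(set D)) (map (sc_restrict A) B) = B"
proof -
  have sub: "E \<subseteq> X" if "E \<in> set B" for E
    using Union_sc[OF assms(2)] that by blast
  then have U: "\<Union>(set (sc_restrict A E)) = E" if "E \<in> set B" for E
    using that Union_sc[OF assms(1)] by auto
  then show map: "map (\<lambda>D. \<Union>(set D)) (map (sc_restrict A) B) = B"
    by (simp add: map_idI)
  have "\<forall>D\<in>set (map (sc_restrict A) B). D \<in> set_compositions (\<Union>(set D))"
    using sc_restrict_in_sc[OF assms(1)] Union_sc[OF assms(1)] by auto
  with map assms(2) concat_in_sc_iff[of "map (sc_restrict A) B" X]
  show "concat (map (sc_restrict A) B) \<in> set_compositions X" "[] \<notin> set (map (sc_restrict A) B)"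
    by auto
qed

section \<open>Linear extensions\<close>

text \<open>Strict comparisons raise the block index and equivalences preserve it. Together this
  says that the index grows weakly along \<open>top_le\<close> and that comparable points share a
  block only when they are equivalent.\<close>

lemma linear_extensions_iff:
  "C \<in> linear_extensions T \<longleftrightarrow> C \<in> set_compositions (topspace T) \<and>
     (\<forall>x y. top_le T x y \<longrightarrow> sc_le C x y \<and> (sc_le C y x \<longrightarrow> top_le T y x))"
proof (intro iffI conjI allI impI)
  assume "C \<in> linear_extensions T"
  then have C: "C \<in> set_compositions (topspace T)"
    and ext: "\<And>i j x y. i < length C \<Longrightarrow> j < length C \<Longrightarrow> x \<in> C ! i \<Longrightarrow> y \<in> C ! j \<Longrightarrow>
      (top_less T x y \<longrightarrow> i < j) \<and> (top_sim T x y \<longrightarrow> i = j)"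
    by (auto simp: linear_extensions_def)
  show "C \<in> set_compositions (topspace T)"
    by (rule C)
  fix x y
  assume le: "top_le T x y"
  then have "x \<in> \<Union>(set C)" "y \<in> \<Union>(set C)"
    using Union_sc[OF C] by (auto simp: top_le_def)
  then obtain i j where ij: "i < length C" "j < length C" "x \<in> C ! i" "y \<in> C ! j"
    by (metis UnionE in_set_conv_nth)
  have "i \<le> j"
    using ext[OF ij] le by (auto simp: top_less_def top_sim_def)
  with ij show "sc_le C x y"
    by (auto simp: sc_le_iff_nth)
  assume "sc_le C y x"
  \<comment> \<open>Disjointness makes block positions unique, so \<open>sc_le\<close> compares the
    given indices themselves.\<close>
  then have "j \<le> i"
    using sc_nth_unique[OF C] ij by (metis sc_le_iff_nth order.strict_trans1)
  with ext[OF ij] le show "top_le T y x"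
    by (auto simp: top_less_def)
next
  assume *: "C \<in> set_compositions (topspace T) \<and>
     (\<forall>x y. top_le T x y \<longrightarrow> sc_le C x y \<and> (sc_le C y x \<longrightarrow> top_le T y x))"
  have nth: "i \<le> j" if "sc_le C x y" "i < length C" "j < length C" "x \<in> C ! i" "y \<in> C ! j" for i j x y
    using that sc_nth_unique * by (metis sc_le_iff_nth order.strict_trans1)
  show "C \<in> linear_extensions T"
    unfolding linear_extensions_def
  proof (intro CollectI conjI allI impI ballI)
    fix i j x y
    assume ij: "i < length C" "j < length C" "x \<in> C ! i" "y \<in> C ! j"
    show "i < j" if "top_less T x y"
    proof (rule ccontr)
      assume "\<not> i < j"
      with ij have "sc_le C y x"
        unfolding sc_le_iff_nth by (metis not_less)
      with * that show False by (auto simp: top_less_def)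
    qed
    show "i = j" if "top_sim T x y"
      using that * nth ij by (meson top_sim_def order.antisym)
  qed (use * in blast)
qed

lemma finite_linear_extensions: "finite (topspace T) \<Longrightarrow> finite (linear_extensions T)"
  by (rule finite_subset[OF _ finite_set_compositions]) (auto simp: linear_extensions_def)

lemma L_map_basis: "L_map (basis T) = (\<Sum>C\<in>linear_extensions T. basis C)"
  by (simp add: L_map_def)

lemma L_map_linear: "Vector_Spaces.linear scale scale L_map"
  unfolding L_map_def by (rule lin_ext_linear)

section \<open>Products\<close>

lemma topspace_top_prod [simp]: "topspace (top_prod T T') = topspace T \<union> topspace T'"
proof (rule antisym)
  have "openin (top_prod T T') (topspace T \<union> topspace T')"
    by (simp add: openin_top_prod Int_absorb1)
  then show "topspace T \<union> topspace T' \<subseteq> topspace (top_prod T T')"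
    by (rule openin_subset)
  show "topspace (top_prod T T') \<subseteq> topspace T \<union> topspace T'"
    using openin_topspace[of "top_prod T T'"] unfolding openin_top_prod by (rule conjunct1)
qed

text \<open>An open set of one factor misses the other and hence is open in the product, so the
  product separates whatever a factor separates.\<close>

lemma top_le_top_prod:
  assumes "topspace T \<inter> topspace T' = {}"
  shows "top_le (top_prod T T') x y \<longleftrightarrow> top_le T x y \<or> top_le T' x y"
proof
  assume *: "top_le (top_prod T T') x y"
  have T: "openin (top_prod T T') U" if "openin T U" for U
  proof -
    have "U \<inter> topspace T = U" "U \<inter> topspace T' = {}"
      using openin_subset[OF that] assms by blast+
    with openin_subset[OF that] that show ?thesis by (auto simp: openin_top_prod)
  qed
  have T': "openin (top_prod T T') U" if "openin T' U" for U
  proof -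
    have "U \<inter> topspace T' = U" "U \<inter> topspace T = {}"
      using openin_subset[OF that] assms by blast+
    with openin_subset[OF that] that show ?thesis by (auto simp: openin_top_prod)
  qed
  show "top_le T x y \<or> top_le T' x y"
    \<comment> \<open>Each whole factor is open, which forces \<open>x\<close> and \<open>y\<close>
      into the same factor.\<close>
    using * T[of "topspace T"] T'[of "topspace T'"] T T' by (auto simp: top_le_def)
next
  assume *: "top_le T x y \<or> top_le T' x y"
  show "top_le (top_prod T T') x y"
    unfolding top_le_def
  proof (intro conjI allI impI)
    fix U
    assume "openin (top_prod T T') U" "x \<in> U"
    then have "openin T (U \<inter> topspace T)" "openin T' (U \<inter> topspace T')"
      by (auto simp: openin_top_prod)
    with * \<open>x \<in> U\<close> show "y \<in> U"
      by (auto simp: top_le_def)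
  qed (use * in \<open>auto simp: top_le_def\<close>)
qed

text \<open>Points of different factors are incomparable, so the condition splits into one for each
  factor, and restriction keeps the preorder inside a factor.\<close>

lemma linear_extensions_top_prod:
  assumes "topspace T \<inter> topspace T' = {}"
  shows "C \<in> linear_extensions (top_prod T T') \<longleftrightarrow>
    C \<in> set_compositions (topspace T \<union> topspace T') \<and>
    sc_restrict C (topspace T) \<in> linear_extensions T \<and>
    sc_restrict C (topspace T') \<in> linear_extensions T'"
proof (cases "C \<in> set_compositions (topspace T \<union> topspace T')")
  case True
  have "sc_restrict C (topspace T) \<in> set_compositions (topspace T)"
    "sc_restrict C (topspace T') \<in> set_compositions (topspace T')"
    using sc_restrict_in_sc[OF True, of "topspace T"] sc_restrict_in_sc[OF True, of "topspace T'"]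
    by (simp_all add: Int_absorb1)
  moreover have "x \<in> topspace T \<and> y \<in> topspace T" if "top_le T x y" for x y
    using that by (simp add: top_le_def)
  moreover have "x \<in> topspace T' \<and> y \<in> topspace T'" if "top_le T' x y" for x y
    using that by (simp add: top_le_def)
  ultimately show ?thesis
    using True assms
    unfolding linear_extensions_iff top_le_top_prod[OF assms] sc_le_restrict topspace_top_prod
    by blast
qed (simp add: linear_extensions_iff)

lemma SC_mult_sum_basis:
  "SC_mult (\<Sum>C\<in>S. basis C) (\<Sum>D\<in>S'. basis D) = (\<Sum>(C, D)\<in>S \<times> S'. sc_prod C D)"
  unfolding SC_mult_def tensor_sum_basis by (rule lin_ext_sum_basis)

lemma sc_prod_eq:
  assumes "C' \<in> set_compositions X" "C'' \<in> set_compositions Y"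
  shows "sc_prod C' C'' = (\<Sum>C | C \<in> set_compositions (X \<union> Y) \<and> sc_restrict C X = C' \<and>
    sc_restrict C Y = C''. basis C)"
  by (simp add: sc_prod_def Union_sc[OF assms(1)] Union_sc[OF assms(2)])

lemma L_map_top_prod:
  assumes "finite (topspace T)" "finite (topspace T')" "topspace T \<inter> topspace T' = {}"
  shows "(L_map (basis (top_prod T T')) :: 'a set list \<Rightarrow>\<^sub>0 'k::field) =
    SC_mult (L_map (basis T)) (L_map (basis T'))"
proof -
  let ?X = "topspace T" and ?Y = "topspace T'"
  let ?R = "\<lambda>C' C''. {C \<in> set_compositions (?X \<union> ?Y). sc_restrict C ?X = C' \<and> sc_restrict C ?Y = C''}"
  have "SC_mult (L_map (basis T)) (L_map (basis T')) =
    (\<Sum>p\<in>linear_extensions T \<times> linear_extensions T'. \<Sum>C\<in>?R (fst p) (snd p). basis C :: 'a set list \<Rightarrow>\<^sub>0 'k)"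
    unfolding L_map_basis SC_mult_sum_basis case_prod_unfold
    by (intro sum.cong refl sc_prod_eq) (auto simp: linear_extensions_iff)
  also have "\<dots> = (\<Sum>(p, C)\<in>(SIGMA p:linear_extensions T \<times> linear_extensions T'. ?R (fst p) (snd p)). basis C)"
    by (rule sum.Sigma)
       (use assms in \<open>auto simp: finite_linear_extensions finite_set_compositions\<close>)
  also have "\<dots> = (\<Sum>C\<in>linear_extensions (top_prod T T'). basis C)"
    \<comment> \<open>The pair \<open>p\<close> is the pair of restrictions of \<open>C\<close>, so
      every \<open>C\<close> occurs exactly once in the double sum.\<close>
    by (rule sum.reindex_bij_witness[where j = snd and
          i = "\<lambda>C. ((sc_restrict C ?X, sc_restrict C ?Y), C)"])
       (auto simp: linear_extensions_top_prod[OF assms(3)])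
  finally show ?thesis
    by (simp add: L_map_basis)
qed

text \<open>Both sides are bilinear. Linearity is applied first in \<open>t\<close>, with a basis
  vector in the other place, and then in \<open>s\<close>.\<close>

lemma L_map_T_mult:
  fixes s t :: "'a topology \<Rightarrow>\<^sub>0 'k::field"
  assumes "finite X" "finite Y" "X \<inter> Y = {}" "s \<in> T_space X" "t \<in> T_space Y"
  shows "L_map (T_mult s t) = SC_mult (L_map s) (L_map t)"
proof -
  have basis: "L_map (T_mult (basis T) (basis T')) = SC_mult (L_map (basis T)) (L_map (basis T') :: 'a set list \<Rightarrow>\<^sub>0 'k)"
    if "T \<in> topologies_on X" "T' \<in> topologies_on Y" for T T'
  proof -
    have "T_mult (basis T) (basis T') = (basis (top_prod T T') :: 'a topology \<Rightarrow>\<^sub>0 'k)"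
      by (simp add: T_mult_def)
    then show ?thesis
      using that assms(1-3) by (simp add: L_map_top_prod topologies_on_def)
  qed
  have left: "Vector_Spaces.linear scale scale (\<lambda>s. L_map (T_mult s t))"
    "Vector_Spaces.linear scale scale (\<lambda>s. SC_mult (L_map s) u)"
    for t :: "'a topology \<Rightarrow>\<^sub>0 'k" and u :: "'a set list \<Rightarrow>\<^sub>0 'k"
    unfolding T_mult_def SC_mult_def
    by (rule linear_comp[OF L_map_linear linear_comp[OF lin_ext_linear tensor_linear_left]]
        linear_comp[OF lin_ext_linear linear_comp[OF tensor_linear_left L_map_linear]])+
  have right: "Vector_Spaces.linear scale scale (\<lambda>t. L_map (T_mult s t))"
    "Vector_Spaces.linear scale scale (\<lambda>t. SC_mult u (L_map t))"
    for s :: "'a topology \<Rightarrow>\<^sub>0 'k" and u :: "'a set list \<Rightarrow>\<^sub>0 'k"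
    unfolding T_mult_def SC_mult_def
    by (rule linear_comp[OF L_map_linear linear_comp[OF lin_ext_linear tensor_linear_right]]
        linear_comp[OF lin_ext_linear linear_comp[OF tensor_linear_right L_map_linear]])+
  have "L_map (T_mult (basis T) t) = SC_mult (L_map (basis T)) (L_map t)" if "T \<in> topologies_on X" for T
    by (rule linear_eq_on_free_space[OF right basis[OF that] assms(5)])
  then show ?thesis
    by (rule linear_eq_on_free_space[OF left _ assms(4)])
qed

section \<open>Coproducts\<close>

lemma top_le_subtopology:
  "top_le (subtopology T Y) x y \<longleftrightarrow> x \<in> Y \<and> y \<in> Y \<and> top_le T x y"
  by (auto simp: top_le_def openin_subtopology)

lemma top_le_trans: "top_le T x y \<Longrightarrow> top_le T y z \<Longrightarrow> top_le T x z"
  by (auto simp: top_le_def)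

lemma top_le_refl: "x \<in> topspace T \<Longrightarrow> top_le T x x"
  by (auto simp: top_le_def)

text \<open>In a finite space the intersection of all open neighbourhoods of a point is open, and it
  consists of the points above that point. Hence every final segment is a union of open
  sets.\<close>

lemma openin_finite_iff:
  assumes "finite (topspace T)"
  shows "openin T U \<longleftrightarrow> U \<subseteq> topspace T \<and> (\<forall>x y. x \<in> U \<longrightarrow> top_le T x y \<longrightarrow> y \<in> U)"
proof (intro iffI conjI allI impI)
  assume *: "U \<subseteq> topspace T \<and> (\<forall>x y. x \<in> U \<longrightarrow> top_le T x y \<longrightarrow> y \<in> U)"
  have "\<exists>V. openin T V \<and> x \<in> V \<and> V \<subseteq> U" if "x \<in> U" for x
  proof -
    have x: "x \<in> topspace T" using that * by blast
    let ?F = "{V. openin T V \<and> x \<in> V}"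
    have "finite ?F"
      by (rule finite_subset[of _ "Pow (topspace T)"]) (use assms openin_subset in auto)
    moreover have "?F \<noteq> {}" using x by auto
    ultimately have "openin T (\<Inter>?F)"
      by (intro openin_Inter) auto
    moreover have "\<Inter>?F \<subseteq> U"
    proof
      fix y assume "y \<in> \<Inter>?F"
      then have "top_le T x y"
        using x by (auto simp: top_le_def)
      with * that show "y \<in> U" by blast
    qed
    ultimately show ?thesis by blast
  qed
  then show "openin T U"
    by (subst openin_subopen) blast
qed (auto simp: top_le_def dest: openin_subset)

lemma topology_eqI_top_le:
  assumes "finite (topspace T)" "topspace T = topspace T'" "\<And>x y. top_le T x y \<longleftrightarrow> top_le T' x y"
  shows "T = T'"
  using assms by (auto simp: topology_eq openin_finite_iff)

text \<open>All points of \<open>C\<close> precede all points of \<open>D\<close>. A comparison from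
  \<open>D\<close> back to \<open>C\<close> is therefore forbidden, which is openness of the union
  of \<open>D\<close>; the remaining conditions concern pairs inside one part.\<close>

lemma linear_extensions_append:
  assumes "finite (topspace T)"
  shows "C @ D \<in> linear_extensions T \<longleftrightarrow> openin T (\<Union>(set D)) \<and>
    C \<in> linear_extensions (subtopology T (topspace T - \<Union>(set D))) \<and>
    D \<in> linear_extensions (subtopology T (\<Union>(set D)))"
proof -
  let ?X = "topspace T" and ?Z = "\<Union>(set C)"
  define Y where "Y = \<Union>(set D)"
  have field: "x \<in> ?X \<and> y \<in> ?X" if "top_le T x y" for x y
    using that by (simp add: top_le_def)
  have fieldC: "x \<in> ?Z \<and> y \<in> ?Z" if "sc_le C x y" for x y
    using that by (rule sc_le_field)
  have fieldD: "x \<in> Y \<and> y \<in> Y" if "sc_le D x y" for x y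
    using sc_le_field[OF that] by (simp add: Y_def)
  have "C @ D \<in> set_compositions ?X \<longleftrightarrow>
    Y \<subseteq> ?X \<and> C \<in> set_compositions (?X - Y) \<and> D \<in> set_compositions Y"
  proof
    assume *: "C @ D \<in> set_compositions ?X"
    then have CD: "?Z \<subseteq> ?X" "C \<in> set_compositions ?Z" "D \<in> set_compositions (?X - ?Z)"
      unfolding sc_append_iff by blast+
    have Y: "Y = ?X - ?Z" unfolding Y_def by (rule Union_sc[OF CD(3)])
    then have "?X - Y = ?Z" using CD(1) by blast
    with CD Y show "Y \<subseteq> ?X \<and> C \<in> set_compositions (?X - Y) \<and> D \<in> set_compositions Y"
      by (metis Diff_subset)
  next
    assume *: "Y \<subseteq> ?X \<and> C \<in> set_compositions (?X - Y) \<and> D \<in> set_compositions Y"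
    then have Z: "?Z = ?X - Y" by (intro Union_sc) blast
    then have "?X - ?Z = Y" using * by blast
    with Z * show "C @ D \<in> set_compositions ?X"
      unfolding sc_append_iff by (metis Diff_subset)
  qed
  \<comment> \<open>Comparisons are sorted by the parts in which their end points lie. Those from
    the complement into \<open>Y\<close> hold strictly by position, whatever \<open>T\<close>
    says.\<close>
  moreover have "(\<forall>x y. top_le T x y \<longrightarrow>
      sc_le (C @ D) x y \<and> (sc_le (C @ D) y x \<longrightarrow> top_le T y x)) \<longleftrightarrow>
    (\<forall>x y. x \<in> Y \<longrightarrow> top_le T x y \<longrightarrow> y \<in> Y) \<and>
    (\<forall>x y. x \<in> ?X - Y \<and> y \<in> ?X - Y \<and> top_le T x y \<longrightarrow>
       sc_le C x y \<and> (sc_le C y x \<longrightarrow> top_le T y x)) \<and>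
    (\<forall>x y. x \<in> Y \<and> y \<in> Y \<and> top_le T x y \<longrightarrow>
       sc_le D x y \<and> (sc_le D y x \<longrightarrow> top_le T y x))" (is "?l \<longleftrightarrow> ?r")
    if "Y \<subseteq> ?X" "C \<in> set_compositions (?X - Y)"
  proof -
    have Z: "?Z = ?X - Y" by (rule Union_sc[OF that(2)])
    have ZZ: "sc_le (C @ D) x y \<longleftrightarrow> sc_le C x y" if "x \<in> ?X - Y" "y \<in> ?X - Y" for x y
      unfolding sc_le_append using that fieldD[of x y] by (auto simp: Y_def)
    have YY: "sc_le (C @ D) x y \<longleftrightarrow> sc_le D x y" if "x \<in> Y" "y \<in> Y" for x y
      unfolding sc_le_append using that fieldC[of x y] Z by blast
    have ZY: "sc_le (C @ D) x y" "\<not> sc_le (C @ D) y x" if "x \<in> ?X - Y" "y \<in> Y" for x y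
      unfolding sc_le_append Z Y_def[symmetric] using that fieldC[of y x] fieldD[of y x] Z by blast+
    show ?thesis
    proof
      assume l: ?l
      have "y \<in> Y" if "x \<in> Y" "top_le T x y" for x y
        using l field[OF that(2)] ZY(2)[of y x] that by blast
      moreover have "sc_le C x y \<and> (sc_le C y x \<longrightarrow> top_le T y x)"
        if "x \<in> ?X - Y" "y \<in> ?X - Y" "top_le T x y" for x y
        using l[rule_format, OF that(3)] unfolding ZZ[OF that(1,2)] ZZ[OF that(2,1)] .
      moreover have "sc_le D x y \<and> (sc_le D y x \<longrightarrow> top_le T y x)"
        if "x \<in> Y" "y \<in> Y" "top_le T x y" for x y
        using l[rule_format, OF that(3)] unfolding YY[OF that(1,2)] YY[OF that(2,1)] .
      ultimately show ?r
        by blast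
    next
      assume r: ?r
      show ?l
      proof (intro allI impI)
        fix x y
        assume le: "top_le T x y"
        consider "x \<in> Y" "y \<in> Y" | "x \<in> ?X - Y" "y \<in> ?X - Y" | "x \<in> ?X - Y" "y \<in> Y"
          using r field[OF le] le by blast
        then show "sc_le (C @ D) x y \<and> (sc_le (C @ D) y x \<longrightarrow> top_le T y x)"
        proof cases
          case 1
          with r le have "sc_le D x y \<and> (sc_le D y x \<longrightarrow> top_le T y x)" by blast
          then show ?thesis unfolding YY[OF 1] YY[OF 1(2,1)] .
        next
          case 2
          with r le have "sc_le C x y \<and> (sc_le C y x \<longrightarrow> top_le T y x)" by blast
          then show ?thesis unfolding ZZ[OF 2] ZZ[OF 2(2,1)] .
        next
          case 3
          with ZY[OF 3] show ?thesis by blast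
        qed
      qed
    qed
  qed
  moreover have "?X \<inter> (?X - Y) = ?X - Y" "Y \<subseteq> ?X \<Longrightarrow> ?X \<inter> Y = Y" by blast+
  ultimately show ?thesis
    unfolding linear_extensions_iff top_le_subtopology openin_finite_iff[OF assms] topspace_subtopology
      Y_def[symmetric]
    by (smt (verit))
qed

text \<open>A linear extension with a cut position corresponds to an open set, the union of the
  blocks after the cut, with linear extensions of the two restrictions. Gluing them puts the cut at
  \<open>length C\<close>.\<close>

lemma SC_Delta_L_map_basis:
  assumes "finite (topspace T)"
  shows "(SC_Delta (L_map (basis T)) :: 'a set list \<times> 'a set list \<Rightarrow>\<^sub>0 'k::field) =
    tensor_map L_map L_map (T_Delta (basis T))"
proof -
  let ?X = "topspace T"
  have fin: "finite {Y. openin T Y}"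
    by (rule finite_subset[of _ "Pow ?X"]) (use assms openin_subset in auto)
  have "SC_Delta (L_map (basis T)) =
    (\<Sum>C\<in>linear_extensions T. \<Sum>i\<le>length C. basis (take i C, drop i C) :: 'a set list \<times> 'a set list \<Rightarrow>\<^sub>0 'k)"
    unfolding SC_Delta_def L_map_basis by (rule lin_ext_sum_basis)
  also have "\<dots> = (\<Sum>(C, i)\<in>(SIGMA C:linear_extensions T. {..length C}). basis (take i C, drop i C))"
    by (rule sum.Sigma) (use assms in \<open>auto simp: finite_linear_extensions\<close>)
  also have "\<dots> = (\<Sum>(Y, p)\<in>(SIGMA Y:{Y. openin T Y}. linear_extensions (subtopology T (?X - Y)) \<times>
      linear_extensions (subtopology T Y)). basis p)"
  proof (rule sum.reindex_bij_witness[where i = "\<lambda>(Y, C, D). (C @ D, length C)" and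
        j = "\<lambda>(C, i). (\<Union>(set (drop i C)), take i C, drop i C)"], goal_cases)
    case (2 q)
    then show ?case
      using linear_extensions_append[OF assms, of "take (snd q) (fst q)" "drop (snd q) (fst q)"]
      by (auto simp: case_prod_unfold)
  next
    case (3 q)
    obtain Y C D where q: "q = (Y, C, D)" by (cases q) auto
    \<comment> \<open>An open \<open>Y\<close> lies in the space, so \<open>subtopology T Y\<close>
      has ground set exactly \<open>Y\<close>, and \<open>Y\<close> is recovered from
      \<open>D\<close>.\<close>
    with 3 have "\<Union>(set D) = Y"
      using openin_subset[of T Y] by (auto simp: linear_extensions_iff Int_absorb1 dest!: Union_sc)
    then show ?case by (simp add: q)
  next
    case (4 q)
    obtain Y C D where q: "q = (Y, C, D)" by (cases q) auto
    with 4 have "\<Union>(set D) = Y"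
      using openin_subset[of T Y] by (auto simp: linear_extensions_iff Int_absorb1 dest!: Union_sc)
    with 4 q show ?case
      using linear_extensions_append[OF assms, of C D] by auto
  qed (auto simp: case_prod_unfold)
  also have "\<dots> = (\<Sum>Y | openin T Y. \<Sum>p\<in>linear_extensions (subtopology T (?X - Y)) \<times>
      linear_extensions (subtopology T Y). basis p)"
    by (rule sum.Sigma[symmetric])
       (use assms fin in \<open>auto intro!: finite_cartesian_product finite_linear_extensions\<close>)
  also have "\<dots> = tensor_map L_map L_map (T_Delta (basis T))"
    by (simp add: T_Delta_def tensor_map_def lin_ext_sum L_map_basis tensor_sum_basis)
  finally show ?thesis .
qed

section \<open>Internal coproducts\<close>

lemma concat_chop: "concat (chop is xs) = take (sum_list is) xs"
  by (induction "is" arbitrary: xs) (auto simp: take_add)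

lemma map_length_chop: "sum_list is \<le> length xs \<Longrightarrow> map length (chop is xs) = is"
  by (induction "is" arbitrary: xs) auto

lemma chop_map_length_concat: "chop (map length xss) (concat xss) = xss"
  by (induction xss) auto

text \<open>A cutting is determined by the lengths of its pieces, and positive lengths mean nonempty
  pieces. Sums over integer compositions can thus run over the lists of pieces themselves.\<close>

lemma bij_betw_chop:
  "bij_betw (\<lambda>is. chop is xs) {is. sum_list is = length xs \<and> (\<forall>i\<in>set is. 1 \<le> i)}
     {xss. concat xss = xs \<and> [] \<notin> set xss}"
proof (rule bij_betw_byWitness[where f' = "map length"])
  show "\<forall>is\<in>{is. sum_list is = length xs \<and> (\<forall>i\<in>set is. 1 \<le> i)}. map length (chop is xs) = is"
    by (simp add: map_length_chop)
  show "\<forall>xss\<in>{xss. concat xss = xs \<and> [] \<notin> set xss}. chop (map length xss) xs = xss"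
    using chop_map_length_concat by blast
  show "(\<lambda>is. chop is xs) ` {is. sum_list is = length xs \<and> (\<forall>i\<in>set is. 1 \<le> i)} \<subseteq>
    {xss. concat xss = xs \<and> [] \<notin> set xss}"
  proof clarify
    fix "is" :: "nat list"
    assume *: "sum_list is = length xs" "\<forall>i\<in>set is. 1 \<le> i"
    have "0 \<in> set (map length (chop is xs))" if "[] \<in> set (chop is xs)"
      using that by force
    with * show "concat (chop is xs) = xs \<and> [] \<notin> set (chop is xs)"
      by (auto simp: concat_chop map_length_chop)
  qed
  show "map length ` {xss. concat xss = xs \<and> [] \<notin> set xss} \<subseteq>
    {is. sum_list is = length xs \<and> (\<forall>i\<in>set is. 1 \<le> i)}"
    by (auto simp: length_concat Suc_le_eq)
qed

text \<open>Each entry is at most \<open>n\<close>, and since all entries are positive there are at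
  most \<open>n\<close> of them.\<close>

lemma finite_positive_compositions: "finite {is. sum_list is = (n :: nat) \<and> (\<forall>i\<in>set is. 1 \<le> i)}"
proof (rule finite_subset[OF _ finite_lists_length_le[of "{..n}" n]])
  have "length is \<le> sum_list is" if "\<forall>i\<in>set is. 1 \<le> i" for "is" :: "nat list"
    using that by (induction "is") auto
  then show "{is. sum_list is = n \<and> (\<forall>i\<in>set is. 1 \<le> i)} \<subseteq> {xs. set xs \<subseteq> {..n} \<and> length xs \<le> n}"
    using member_le_sum_list by fastforce
qed simp

lemma finite_deconcatenations: "finite {xss. concat xss = xs \<and> [] \<notin> set xss}"
  using bij_betw_finite[OF bij_betw_chop] finite_positive_compositions by blast

text \<open>Restrictions compose, so the conditions that the inductive hypothesis puts on the
  restriction of \<open>A\<close> to the later pieces can be read as conditions on \<open>A\<close>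
  itself.\<close>

lemma SC_prod_list_eq:
  assumes "finite Z" "map (\<lambda>D. \<Union>(set D)) Ds \<in> set_compositions Z"
    "\<forall>D\<in>set Ds. D \<in> set_compositions (\<Union>(set D))"
  shows "(SC_prod_list Ds :: 'a set list \<Rightarrow>\<^sub>0 'k::field) =
    (\<Sum>A | A \<in> set_compositions Z \<and> (\<forall>D\<in>set Ds. sc_restrict A (\<Union>(set D)) = D). basis A)"
  using assms
proof (induction Ds arbitrary: Z)
  case Nil
  have "A \<in> set_compositions {} \<longleftrightarrow> A = []" for A :: "'a set list"
    by (cases A) (auto simp: sc_Cons_iff)
  with Nil show ?case
    by (simp add: SC_prod_list_def)
next
  case (Cons D Ds)
  let ?Y = "\<Union>(set D)"
  let ?S = "{E. E \<in> set_compositions (Z - ?Y) \<and> (\<forall>D\<in>set Ds. sc_restrict E (\<Union>(set D)) = D)}"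
  let ?R = "\<lambda>D E. {A. A \<in> set_compositions (?Y \<union> (Z - ?Y)) \<and> sc_restrict A ?Y = D \<and> sc_restrict A (Z - ?Y) = E}"
  have Y: "?Y \<subseteq> Z" and Ds: "map (\<lambda>D. \<Union>(set D)) Ds \<in> set_compositions (Z - ?Y)"
    using Cons.prems(2) by (auto simp: sc_Cons_iff)
  have Z: "?Y \<union> (Z - ?Y) = Z" using Y by blast
  have sub: "\<Union>(set D') \<subseteq> Z - ?Y" if "D' \<in> set Ds" for D'
    using Union_sc[OF Ds] that by auto
  have restrict: "sc_restrict (sc_restrict A (Z - ?Y)) (\<Union>(set D')) = sc_restrict A (\<Union>(set D'))"
    if "D' \<in> set Ds" for A D'
    using sub[OF that] by (simp add: sc_restrict_restrict Int_absorb1)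
  have rest: "sc_restrict A (Z - ?Y) \<in> set_compositions (Z - ?Y)" if "A \<in> set_compositions Z" for A
    using sc_restrict_in_sc[OF that, of "Z - ?Y"] by (simp add: Int_absorb1)
  have IH: "(SC_prod_list Ds :: 'a set list \<Rightarrow>\<^sub>0 'k) = (\<Sum>E\<in>?S. basis E)"
    using Cons.prems by (intro Cons.IH Ds) auto
  \<comment> \<open>The factor \<open>basis D\<close> is written as a one-term sum to fit
    \<open>SC_mult_sum_basis\<close>.\<close>
  have "(SC_prod_list (D # Ds) :: 'a set list \<Rightarrow>\<^sub>0 'k) = SC_mult (\<Sum>C\<in>{D}. basis C) (SC_prod_list Ds)"
    by (simp add: SC_prod_list_def)
  also have "\<dots> = (\<Sum>p\<in>{D} \<times> ?S. \<Sum>A\<in>?R (fst p) (snd p). basis A)"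
    unfolding IH SC_mult_sum_basis case_prod_unfold
    by (intro sum.cong refl sc_prod_eq) (use Cons.prems(3) in auto)
  also have "\<dots> = (\<Sum>(p, A)\<in>(SIGMA p:{D} \<times> ?S. ?R (fst p) (snd p)). basis A)"
    by (rule sum.Sigma) (use Cons.prems(1) Z in \<open>auto simp: finite_set_compositions\<close>)
  also have "\<dots> = (\<Sum>A | A \<in> set_compositions Z \<and> (\<forall>D'\<in>set (D # Ds). sc_restrict A (\<Union>(set D')) = D').
      basis A)"
    unfolding Z
    by (rule sum.reindex_bij_witness[where j = snd and i = "\<lambda>A. ((D, sc_restrict A (Z - ?Y)), A)"])
       (auto simp: rest restrict)
  finally show ?case .
qed

lemma SC_rho_basis:
  assumes "finite X" "C \<in> set_compositions X"
  shows "(SC_rho (basis C) :: 'a set list \<times> 'a set list \<Rightarrow>\<^sub>0 'k::field) =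
    (\<Sum>Ds | concat Ds = C \<and> [] \<notin> set Ds.
       \<Sum>A | A \<in> set_compositions X \<and> (\<forall>D\<in>set Ds. sc_restrict A (\<Union>(set D)) = D).
         basis (A, map (\<lambda>D. \<Union>(set D)) Ds))"
proof -
  have "SC_rho (basis C) = (\<Sum>Ds | concat Ds = C \<and> [] \<notin> set Ds.
    SC_prod_list Ds \<otimes>\<^sub>v (basis (map (\<lambda>D. \<Union>(set D)) Ds) :: 'a set list \<Rightarrow>\<^sub>0 'k))"
    unfolding SC_rho_def lin_ext_basis by (rule sum.reindex_bij_betw[OF bij_betw_chop])
  also have "\<dots> = (\<Sum>Ds | concat Ds = C \<and> [] \<notin> set Ds.
       \<Sum>A | A \<in> set_compositions X \<and> (\<forall>D\<in>set Ds. sc_restrict A (\<Union>(set D)) = D).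
         basis (A, map (\<lambda>D. \<Union>(set D)) Ds))"
  proof (rule sum.cong[OF refl])
    fix Ds
    assume "Ds \<in> {Ds. concat Ds = C \<and> [] \<notin> set Ds}"
    then have "map (\<lambda>D. \<Union>(set D)) Ds \<in> set_compositions X" "\<forall>D\<in>set Ds. D \<in> set_compositions (\<Union>(set D))"
      using concat_in_sc_iff[of Ds X] assms(2) by auto
    from SC_prod_list_eq[OF assms(1) this, where ?'k = 'k]
    show "SC_prod_list Ds \<otimes>\<^sub>v (basis (map (\<lambda>D. \<Union>(set D)) Ds) :: 'a set list \<Rightarrow>\<^sub>0 'k) =
      (\<Sum>A | A \<in> set_compositions X \<and> (\<forall>D\<in>set Ds. sc_restrict A (\<Union>(set D)) = D).
         basis (A, map (\<lambda>D. \<Union>(set D)) Ds))"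
      by (simp add: tensor_sum_left)
  qed
  finally show ?thesis .
qed

text \<open>In a triple of \<open>C\<close>, \<open>Ds\<close> and \<open>A\<close>, the pieces are
  the restrictions of \<open>A\<close> to the blocks \<open>B\<close>, and \<open>C\<close> is their
  concatenation. The pair \<open>(A, B)\<close> thus determines the triple, and no term
  repeats.\<close>

lemma SC_rho_L_map_basis_sum:
  assumes "finite (topspace T)"
  shows "(SC_rho (L_map (basis T)) :: 'a set list \<times> 'a set list \<Rightarrow>\<^sub>0 'k::field) =
    (\<Sum>(A, B) | A \<in> set_compositions (topspace T) \<and> B \<in> set_compositions (topspace T) \<and>
       concat (map (sc_restrict A) B) \<in> linear_extensions T. basis (A, B))"
proof -
  let ?X = "topspace T"
  let ?D = "\<lambda>C :: 'a set list. {Ds. concat Ds = C \<and> [] \<notin> set Ds}"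
  let ?A = "\<lambda>Ds. {A. A \<in> set_compositions ?X \<and> (\<forall>D\<in>set Ds. sc_restrict A (\<Union>(set D)) = D)}"
  have sc: "C \<in> set_compositions ?X" if "C \<in> linear_extensions T" for C
    using that by (simp add: linear_extensions_iff)
  have "SC_rho (L_map (basis T)) = (\<Sum>C\<in>linear_extensions T. SC_rho (basis C) :: 'a set list \<times> 'a set list \<Rightarrow>\<^sub>0 'k)"
    unfolding SC_rho_def L_map_basis by (rule lin_ext_sum)
  also have "\<dots> = (\<Sum>C\<in>linear_extensions T. \<Sum>Ds\<in>?D C. \<Sum>A\<in>?A Ds. basis (A, map (\<lambda>D. \<Union>(set D)) Ds))"
    by (rule sum.cong[OF refl]) (rule SC_rho_basis[OF assms sc])
  also have "\<dots> = (\<Sum>(C, Ds)\<in>(SIGMA C:linear_extensions T. ?D C). \<Sum>A\<in>?A Ds. basis (A, map (\<lambda>D. \<Union>(set D)) Ds))"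
    by (rule sum.Sigma) (use assms in \<open>auto simp: finite_linear_extensions finite_deconcatenations\<close>)
  also have "\<dots> = (\<Sum>q\<in>(SIGMA C:linear_extensions T. ?D C). \<Sum>A\<in>?A (snd q). basis (A, map (\<lambda>D. \<Union>(set D)) (snd q)))"
    by (simp add: case_prod_unfold)
  also have "\<dots> = (\<Sum>(q, A)\<in>(SIGMA q:(SIGMA C:linear_extensions T. ?D C). ?A (snd q)).
      basis (A, map (\<lambda>D. \<Union>(set D)) (snd q)))"
    by (rule sum.Sigma)
       (use assms in \<open>auto intro!: finite_SigmaI simp: finite_linear_extensions finite_deconcatenations finite_set_compositions\<close>)
  also have "\<dots> = (\<Sum>(A, B) | A \<in> set_compositions ?X \<and> B \<in> set_compositions ?X \<and>
       concat (map (sc_restrict A) B) \<in> linear_extensions T. basis (A, B))"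
  proof (rule sum.reindex_bij_witness[where
        j = "\<lambda>((C, Ds), A). (A, map (\<lambda>D. \<Union>(set D)) Ds)" and
        i = "\<lambda>(A, B). ((concat (map (sc_restrict A) B), map (sc_restrict A) B), A)"], goal_cases)
    case (1 a)
    obtain C Ds A where a: "a = ((C, Ds), A)" by (metis surj_pair)
    \<comment> \<open>Every piece is the restriction of \<open>A\<close> to the union of that
      piece.\<close>
    with 1 have "map (sc_restrict A) (map (\<lambda>D. \<Union>(set D)) Ds) = Ds"
      by (auto intro!: map_idI)
    with 1 a show ?case by auto
  next
    case (2 a)
    obtain C Ds A where a: "a = ((C, Ds), A)" by (metis surj_pair)
    with 2 have "map (sc_restrict A) (map (\<lambda>D. \<Union>(set D)) Ds) = Ds"
      by (auto intro!: map_idI)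
    moreover have "map (\<lambda>D. \<Union>(set D)) Ds \<in> set_compositions ?X"
      using concat_in_sc_iff[of Ds ?X] 2 sc a by auto
    ultimately show ?case using 2 a by auto
  next
    case (3 b)
    obtain A B where b: "b = (A, B)" by (metis surj_pair)
    with 3 show ?case using concat_restrict_in_sc(3)[of A ?X B] by simp
  next
    case (4 b)
    obtain A B where b: "b = (A, B)" by (metis surj_pair)
    have "sc_restrict A (\<Union>(set (sc_restrict A E))) = sc_restrict A E" if "E \<in> set B" for E
    proof -
      have "E \<subseteq> ?X" using 4 b that Union_sc[of B ?X] by auto
      then have "\<Union>(set (sc_restrict A E)) = E"
        using 4 b Union_sc[of A ?X] by auto
      then show ?thesis by simp
    qed
    moreover have "[] \<notin> set (map (sc_restrict A) B)"
      using 4 b by (intro concat_restrict_in_sc(2)) auto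
    ultimately show ?case using 4 b by auto
  qed (auto simp: case_prod_unfold)
  finally show ?thesis .
qed

section \<open>Quotient topologies and connected components\<close>

lemma top_le_finer: "T' \<prec>\<^sub>T T \<Longrightarrow> top_le T' x y \<Longrightarrow> top_le T x y"
  by (auto simp: finer_def top_le_def)

lemma topspace_top_quot [simp]: "topspace (T /\<^sub>T T') = topspace T"
  by (simp add: top_quot_def)

lemma top_le_quot_self:
  "top_le (T /\<^sub>T T) = (\<lambda>x y. top_le T x y \<or> top_le T y x)\<^sup>+\<^sup>+"
  by (rule top_le_top_quot) (simp add: finer_def)

lemma top_le_quot_self_sym: "top_le (T /\<^sub>T T) x y \<Longrightarrow> top_le (T /\<^sub>T T) y x"
  unfolding top_le_quot_self
  by (induction rule: tranclp_induct) (auto intro: tranclp_into_tranclp2)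

lemma top_le_quot_mono:
  assumes "T' \<prec>\<^sub>T T" "top_le (T' /\<^sub>T T') x y"
  shows "top_le (T /\<^sub>T T') x y"
  using assms(2) unfolding top_le_quot_self top_le_top_quot[OF assms(1)]
  by (induction rule: tranclp_induct)
     (use top_le_finer[OF assms(1)] in \<open>blast intro: tranclp.intros\<close>)+

text \<open>Every open set around \<open>x\<close> contains \<open>y\<close>, so no two open sets
  can separate the set of these two points.\<close>

lemma connected_component_of_top_le:
  assumes "top_le T x y"
  shows "connected_component_of T x y"
proof -
  have "connectedin T {x, y}"
    using assms unfolding connectedin top_le_def by blast
  then show ?thesis
    unfolding connected_component_of_def by blast
qed

text \<open>A chain of comparabilities stays in one component. This turns the equivalence condition
  of \<open>admissible\<close> into a connected set, on which the restriction condition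
  applies.\<close>

lemma connected_component_of_quot_self:
  assumes "top_le (T /\<^sub>T T) x y"
  shows "connected_component_of T x y"
  using assms unfolding top_le_quot_self
proof (induction rule: tranclp_induct)
  case (base y)
  then show ?case
    using connected_component_of_top_le connected_component_of_sym by metis
next
  case (step y z)
  then show ?case
    using connected_component_of_top_le connected_component_of_sym connected_component_of_trans by metis
qed

text \<open>The product of the restrictions of \<open>T\<close> to the blocks of \<open>B\<close>.\<close>

definition block_topology :: "'a topology \<Rightarrow> 'a set list \<Rightarrow> 'a topology" where
  "block_topology T B = top_of_order (topspace T) (\<lambda>x y. top_le T x y \<and> sc_le B x y \<and> sc_le B y x)"

lemma topspace_block_topology [simp]: "topspace (block_topology T B) = topspace T"
  by (simp add: block_topology_def)

lemma top_le_block_topology: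
  assumes "B \<in> set_compositions (topspace T)"
  shows "top_le (block_topology T B) x y \<longleftrightarrow> top_le T x y \<and> sc_le B x y \<and> sc_le B y x"
  unfolding block_topology_def
proof (subst top_le_top_of_order)
  show "top_le T x x \<and> sc_le B x x \<and> sc_le B x x" if "x \<in> topspace T" for x
    using that Union_sc[OF assms] by (simp add: top_le_refl sc_le_refl)
  show "top_le T x z \<and> sc_le B x z \<and> sc_le B z x"
    if "top_le T x y \<and> sc_le B x y \<and> sc_le B y x" "top_le T y z \<and> sc_le B y z \<and> sc_le B z y" for x y z
    using that top_le_trans sc_le_trans[OF assms] by metis
qed (auto simp: top_le_def)

lemma block_topology_finer: "block_topology T B \<prec>\<^sub>T T"
  by (auto simp: finer_def block_topology_def openin_top_of_order top_le_def dest: openin_subset)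

text \<open>The block of \<open>x\<close> and its complement are both open, since the block order
  relates only points of a common block. A connected set that meets the block stays inside
  it.\<close>

lemma connectedin_block_topology:
  assumes B: "B \<in> set_compositions (topspace T)" and Y: "connectedin (block_topology T B) Y"
    and "x \<in> Y" "y \<in> Y"
  shows "sc_le B x y"
proof -
  let ?T' = "block_topology T B"
  let ?U = "{z \<in> topspace T. sc_le B x z \<and> sc_le B z x}"
  have sub: "Y \<subseteq> topspace T"
    using connectedin_subset_topspace[OF Y] by simp
  then have x: "sc_le B x x"
    using assms(3) Union_sc[OF B] by (blast intro: sc_le_refl)
  note trans = sc_le_trans[OF B]
  have "openin ?T' ?U" "openin ?T' (topspace T - ?U)"
    unfolding block_topology_def openin_top_of_order using trans by blast+
  moreover have "Y \<subseteq> ?U \<union> (topspace T - ?U)" "?U \<inter> (topspace T - ?U) \<inter> Y = {}" "?U \<inter> Y \<noteq> {}"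
    using sub assms(3) x by blast+
  ultimately have "(topspace T - ?U) \<inter> Y = {}"
    using Y unfolding connectedin by meson
  with sub assms(4) show ?thesis by blast
qed

text \<open>Every step of the relation generating the quotient moves weakly upwards in
  \<open>B\<close>. A chain with both ends in one block never leaves it, so all of its steps are
  comparabilities of the block topology.\<close>

lemma block_topology_admissible:
  assumes fin: "finite (topspace T)"
    and A: "A \<in> set_compositions (topspace T)" and B: "B \<in> set_compositions (topspace T)"
    and C: "concat (map (sc_restrict A) B) \<in> linear_extensions T"
  shows "admissible T (block_topology T B)" "A \<in> linear_extensions (block_topology T B)"
    "B \<in> linear_extensions (T /\<^sub>T block_topology T B)"
proof -
  let ?T' = "block_topology T B"
  note finer = block_topology_finer[of T B]
  note le' = top_le_block_topology[OF B]
  note trans = sc_le_trans[OF B]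
  have le_C: "sc_le (concat (map (sc_restrict A) B)) x y \<longleftrightarrow> sc_le B x y \<and> (sc_le B y x \<longrightarrow> sc_le A x y)" for x y
    using sc_le_concat_restrict[OF B] Union_sc[OF A] by simp
  have T: "sc_le B x y \<and> (sc_le B y x \<longrightarrow> sc_le A x y)"
    "sc_le B y x \<and> (sc_le B x y \<longrightarrow> sc_le A y x) \<Longrightarrow> top_le T y x" if "top_le T x y" for x y
    using that C unfolding linear_extensions_iff le_C by blast+
  have quot: "sc_le B x y" if "top_le (T /\<^sub>T ?T') x y" for x y
    using that unfolding top_le_top_quot[OF finer]
    by (induction rule: tranclp_induct) (use T(1) le' trans in blast)+
  have quot': "top_le (?T' /\<^sub>T ?T') x y" if "top_le (T /\<^sub>T ?T') x y" "sc_le B y x" for x y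
    using that unfolding top_le_top_quot[OF finer]
  proof (induction rule: tranclp_induct)
    case (base y)
    then show ?case
      unfolding top_le_quot_self using T(1) le' by blast
  next
    case (step y z)
    have xy: "sc_le B x y"
      using quot step.hyps(1) unfolding top_le_top_quot[OF finer] by blast
    have yz: "sc_le B y z"
      using step.hyps(2) T(1) le' by blast
    \<comment> \<open>From \<open>y\<close> below \<open>z\<close> and \<open>z\<close> below
      \<open>x\<close> in \<open>B\<close>, the point \<open>y\<close> also lies below
      \<open>x\<close>, as the induction hypothesis requires.\<close>
    have "top_le (?T' /\<^sub>T ?T') x y"
      by (rule step.IH[OF trans[OF yz step.prems]])
    moreover have "top_le ?T' y z \<or> top_le ?T' z y"
      using step.hyps(2) le' yz trans[OF step.prems xy] by blast
    ultimately show ?case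
      unfolding top_le_quot_self by (rule tranclp.trancl_into_trancl)
  qed
  have "subtopology ?T' Y = subtopology T Y" if "connectedin ?T' Y" for Y
    by (rule topology_eqI_top_le)
       (use fin connectedin_block_topology[OF B that] in \<open>auto simp: top_le_subtopology le'\<close>)
  moreover have "top_sim (T /\<^sub>T ?T') x y \<longleftrightarrow> top_sim (?T' /\<^sub>T ?T') x y" for x y
    unfolding top_sim_def using quot quot' top_le_quot_mono[OF finer] by blast
  ultimately show "admissible T ?T'"
    unfolding admissible_def using finer by blast
  show "A \<in> linear_extensions ?T'"
    unfolding linear_extensions_iff using A T le' by auto
  \<comment> \<open>A chain whose ends share a block gives a relation in the self-quotient, which is
    symmetric; reversing it yields the comparison back in the quotient of \<open>T\<close>.\<close>
  show "B \<in> linear_extensions (T /\<^sub>T ?T')"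
    unfolding linear_extensions_iff topspace_top_quot
    using B quot quot' top_le_quot_self_sym[of ?T'] top_le_quot_mono[OF finer] by blast
qed

text \<open>Two points of one block with \<open>x\<close> \<le> \<open>y\<close> in \<open>T\<close>
  are equivalent in the quotient, hence joined by a \<open>T'\<close>-connected set, on which
  \<open>T'\<close> and \<open>T\<close> agree. This forces \<open>T'\<close> to be the block
  topology.\<close>

lemma admissible_unique:
  assumes fin: "finite (topspace T)" and adm: "admissible T T'"
    and A: "A \<in> linear_extensions T'" and B: "B \<in> linear_extensions (T /\<^sub>T T')"
  shows "T' = block_topology T B" "concat (map (sc_restrict A) B) \<in> linear_extensions T"
    "A \<in> set_compositions (topspace T)" "B \<in> set_compositions (topspace T)"
proof -
  have finer: "T' \<prec>\<^sub>T T" and top: "topspace T' = topspace T"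
    using adm by (auto simp: admissible_def finer_def)
  show sc: "A \<in> set_compositions (topspace T)" "B \<in> set_compositions (topspace T)"
    using A B top by (auto simp: linear_extensions_iff)
  have quot: "top_le (T /\<^sub>T T') x y" if "top_le T x y \<or> top_le T' y x" for x y
    unfolding top_le_top_quot[OF finer] using that by blast
  have BT: "sc_le B x y" if "top_le T x y" for x y
    using quot B that by (auto simp: linear_extensions_iff)
  \<comment> \<open>A comparison in \<open>T'\<close> enters the quotient in both directions, so
    \<open>B\<close> must place its ends in one block.\<close>
  have T'_imp: "top_le T x y \<and> sc_le B x y \<and> sc_le B y x" if "top_le T' x y" for x y
    using top_le_finer[OF finer that] BT quot that B by (auto simp: linear_extensions_iff)
  have imp_T': "top_le T' x y" if "top_le T x y" "sc_le B y x" for x y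
  proof -
    have X: "x \<in> topspace T" "y \<in> topspace T"
      using that(1) by (auto simp: top_le_def)
    \<comment> \<open>A linear extension puts comparable points in one block only if they are
      equivalent.\<close>
    have "top_sim (T /\<^sub>T T') x y"
      using quot that B by (auto simp: linear_extensions_iff top_sim_def)
    then have "top_le (T' /\<^sub>T T') x y"
      using adm X by (auto simp: admissible_def top_sim_def)
    then obtain Y where Y: "connectedin T' Y" "x \<in> Y" "y \<in> Y"
      using connected_component_of_quot_self unfolding connected_component_of_def by metis
    then have "top_le (subtopology T' Y) x y \<longleftrightarrow> top_le (subtopology T Y) x y"
      using adm by (simp add: admissible_def)
    with Y that(1) show ?thesis
      by (simp add: top_le_subtopology)
  qed
  show "T' = block_topology T B"
  proof (rule topology_eqI_top_le)
    show "top_le T' x y \<longleftrightarrow> top_le (block_topology T B) x y" for x y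
      unfolding top_le_block_topology[OF sc(2)] using T'_imp imp_T' by blast
  qed (simp_all add: fin top)
  have "sc_le (concat (map (sc_restrict A) B)) x y \<longleftrightarrow> sc_le B x y \<and> (sc_le B y x \<longrightarrow> sc_le A x y)" for x y
    using sc_le_concat_restrict[OF sc(2)] Union_sc[OF sc(1)] by simp
  moreover have "sc_le A x y \<and> (sc_le A y x \<longrightarrow> top_le T' y x)" if "top_le T' x y" for x y
    using that A by (auto simp: linear_extensions_iff)
  ultimately show "concat (map (sc_restrict A) B) \<in> linear_extensions T"
    unfolding linear_extensions_iff
    using concat_restrict_in_sc(1)[OF sc] BT imp_T' T'_imp by metis
qed

lemma finite_admissible:
  assumes "finite (topspace T)"
  shows "finite {T'. admissible T T'}"
proof (rule inj_on_finite)
  show "inj_on (\<lambda>T'. {U. openin T' U}) {T'. admissible T T'}"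
    by (rule inj_onI) (auto simp: topology_eq)
  show "(\<lambda>T'. {U. openin T' U}) ` {T'. admissible T T'} \<subseteq> Pow (Pow (topspace T))"
  proof clarify
    fix T' U x
    assume "admissible T T'" "openin T' U" "x \<in> U"
    then show "x \<in> topspace T"
      using openin_subset[of T' U] by (auto simp: admissible_def finer_def)
  qed
qed (use assms in simp)

text \<open>The admissible \<open>T'\<close> is recovered from \<open>B\<close>, so forgetting it is
  a bijection onto the pairs that index the expansion of the other side.\<close>

lemma SC_rho_L_map_basis:
  assumes "finite (topspace T)"
  shows "(SC_rho (L_map (basis T)) :: 'a set list \<times> 'a set list \<Rightarrow>\<^sub>0 'k::field) =
    tensor_map L_map L_map (T_Gamma (basis T))"
proof -
  let ?X = "topspace T"
  let ?E = "\<lambda>T'. linear_extensions T' \<times> linear_extensions (T /\<^sub>T T')"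
  have "tensor_map L_map L_map (T_Gamma (basis T)) =
    (\<Sum>T' | admissible T T'. \<Sum>p\<in>?E T'. basis p :: 'a set list \<times> 'a set list \<Rightarrow>\<^sub>0 'k)"
    by (simp add: T_Gamma_def tensor_map_def lin_ext_sum L_map_basis tensor_sum_basis)
  also have "\<dots> = (\<Sum>(T', p)\<in>(SIGMA T':{T'. admissible T T'}. ?E T'). basis p)"
  proof (rule sum.Sigma[OF finite_admissible[OF assms]], rule ballI)
    fix T'
    assume "T' \<in> {T'. admissible T T'}"
    then have "topspace T' = topspace T"
      by (simp add: admissible_def finer_def)
    then show "finite (?E T')"
      using assms by (intro finite_cartesian_product finite_linear_extensions) simp_all
  qed
  also have "\<dots> = (\<Sum>(A, B) | A \<in> set_compositions ?X \<and> B \<in> set_compositions ?X \<and>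
       concat (map (sc_restrict A) B) \<in> linear_extensions T. basis (A, B))"
  proof (rule sum.reindex_bij_witness[where j = snd and i = "\<lambda>(A, B). (block_topology T B, A, B)"], goal_cases)
    case (1 q)
    obtain T' A B where q: "q = (T', A, B)" by (metis surj_pair)
    with 1 have "T' = block_topology T B"
      by (intro admissible_unique(1)[OF assms, of T' A B]) auto
    with q show ?case by simp
  next
    case (2 q)
    obtain T' A B where q: "q = (T', A, B)" by (metis surj_pair)
    with 2 admissible_unique(2-4)[OF assms, of T' A B] show ?case by auto
  next
    case (4 p)
    then show ?case
      using block_topology_admissible[OF assms] by auto
  qed auto
  also have "\<dots> = SC_rho (L_map (basis T))"
    by (rule SC_rho_L_map_basis_sum[OF assms, symmetric])
  finally show ?thesis by (rule sym)
qed

section \<open>Surjectivity\<close>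

lemma lin_ext_in_free_space:
  assumes "v \<in> free_space B" "\<And>b. b \<in> B \<Longrightarrow> f b \<in> free_space B'"
  shows "lin_ext f v \<in> free_space B'"
proof -
  have "c \<in> B'" if "c \<in> Poly_Mapping.keys (lin_ext f v)" for c
  proof -
    have "(\<Sum>b\<in>Poly_Mapping.keys v. Poly_Mapping.lookup v b * Poly_Mapping.lookup (f b) c) \<noteq> 0"
      using that by (simp add: in_keys_iff lin_ext_def lookup_sum)
    then obtain b where "b \<in> Poly_Mapping.keys v" "Poly_Mapping.lookup v b * Poly_Mapping.lookup (f b) c \<noteq> 0"
      by (meson sum.neutral)
    then show ?thesis
      using assms by (force simp: free_space_def in_keys_iff)
  qed
  then show ?thesis by (auto simp: free_space_def)
qed

text \<open>A linear extension contains the preorder of \<open>C\<close>. Totality leaves no room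
  for more: an extra comparison would reverse one of \<open>C\<close>, and the extension condition
  then carries it back to \<open>C\<close>.\<close>

lemma linear_extensions_total_preorder:
  assumes "C \<in> set_compositions X"
  shows "linear_extensions (top_of_order X (sc_le C)) = {C}"
proof -
  note U = Union_sc[OF assms]
  have le: "top_le (top_of_order X (sc_le C)) x y \<longleftrightarrow> sc_le C x y" for x y
    using sc_le_field[of C x y] U
    by (subst top_le_top_of_order) (auto intro: sc_le_refl sc_le_trans[OF assms])
  have "D = C" if D: "D \<in> set_compositions X"
    and ext: "\<And>x y. sc_le C x y \<Longrightarrow> sc_le D x y \<and> (sc_le D y x \<longrightarrow> sc_le C y x)" for D
  proof (rule sc_eqI[OF D assms])
    fix x y
    show "sc_le D x y \<longleftrightarrow> sc_le C x y"
    proof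
      assume le: "sc_le D x y"
      then have "sc_le C x y \<or> sc_le C y x"
        using sc_le_field[OF le] unfolding Union_sc[OF D] U[symmetric] by (intro sc_le_total) auto
      with ext le show "sc_le C x y" by blast
    qed (use ext in blast)
  qed
  then have "linear_extensions (top_of_order X (sc_le C)) \<subseteq> {C}"
    unfolding linear_extensions_iff le topspace_top_of_order subset_iff by blast
  moreover have "C \<in> linear_extensions (top_of_order X (sc_le C))"
    unfolding linear_extensions_iff le topspace_top_of_order using assms by blast
  ultimately show ?thesis by blast
qed

lemma L_map_image_T_space:
  assumes "finite X"
  shows "L_map ` (T_space X :: ('a topology \<Rightarrow>\<^sub>0 'k::field) set) = SC_space X"
proof (intro equalityI subsetI)
  fix v :: "'a set list \<Rightarrow>\<^sub>0 'k"
  assume "v \<in> L_map ` T_space X"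
  then obtain t :: "'a topology \<Rightarrow>\<^sub>0 'k" where t: "t \<in> T_space X" "v = L_map t" by blast
  have "(\<Sum>C\<in>linear_extensions T. basis C :: 'a set list \<Rightarrow>\<^sub>0 'k) \<in> SC_space X" if "T \<in> topologies_on X" for T
  proof -
    have "Poly_Mapping.keys (\<Sum>C\<in>linear_extensions T. basis C :: 'a set list \<Rightarrow>\<^sub>0 'k) \<subseteq> linear_extensions T"
      by (rule order_trans[OF keys_sum]) auto
    then show ?thesis
      using that by (auto simp: free_space_def topologies_on_def linear_extensions_def)
  qed
  then show "v \<in> SC_space X"
    unfolding t(2) L_map_def by (rule lin_ext_in_free_space[OF t(1)])
next
  fix v :: "'a set list \<Rightarrow>\<^sub>0 'k"
  assume v: "v \<in> SC_space X"
  \<comment> \<open>The linear extension of this map is a right inverse of \<open>L_map\<close> on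
    \<open>SC_space X\<close>.\<close>
  let ?f = "\<lambda>C. basis (top_of_order X (sc_le C)) :: 'a topology \<Rightarrow>\<^sub>0 'k"
  have "lin_ext ?f v \<in> T_space X"
    by (rule lin_ext_in_free_space[OF v]) (simp add: free_space_def topologies_on_def)
  moreover have "L_map (lin_ext ?f v) = v"
  proof (rule linear_eq_on_free_space[OF _ _ _ v, where f = "\<lambda>v. L_map (lin_ext ?f v)" and g = "\<lambda>v. v"])
    show "Vector_Spaces.linear scale scale (\<lambda>v. L_map (lin_ext ?f v))"
      by (rule linear_comp[OF L_map_linear lin_ext_linear])
    show "Vector_Spaces.linear scale scale (\<lambda>v :: 'a set list \<Rightarrow>\<^sub>0 'k. v)"
      by (rule vector_space.linear_ident[OF vector_space_scale])
    show "L_map (lin_ext ?f (basis C)) = basis C" if "C \<in> set_compositions X" for C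
      using that by (simp add: L_map_basis linear_extensions_total_preorder)
  qed
  ultimately show "v \<in> L_map ` T_space X"
    by (metis imageI)
qed

theorem theorem5p5:
  shows "(\<forall>X Y. finite X \<longrightarrow> finite Y \<longrightarrow> X \<inter> Y = {} \<longrightarrow>
           (\<forall>s \<in> (T_space X :: ('a topology \<Rightarrow>\<^sub>0 'k::field) set).
            \<forall>t \<in> (T_space Y :: ('a topology \<Rightarrow>\<^sub>0 'k) set).
              L_map (T_mult s t) = SC_mult (L_map s) (L_map t)))
       \<and> (\<forall>X. finite X \<longrightarrow> (\<forall>t \<in> (T_space X :: ('a topology \<Rightarrow>\<^sub>0 'k) set).
              SC_Delta (L_map t) = tensor_map L_map L_map (T_Delta t)))
       \<and> (\<forall>X. finite X \<longrightarrow> (\<forall>t \<in> (T_space X :: ('a topology \<Rightarrow>\<^sub>0 'k) set).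
              SC_rho (L_map t) = tensor_map L_map L_map (T_Gamma t)))
       \<and> (\<forall>X. finite X \<longrightarrow>
              L_map ` (T_space X :: ('a topology \<Rightarrow>\<^sub>0 'k) set) = SC_space X)"
proof (intro conjI allI impI ballI)
  fix X and t :: "'a topology \<Rightarrow>\<^sub>0 'k"
  assume "finite X" and t: "t \<in> T_space X"
  then have fin: "finite (topspace T)" if "T \<in> topologies_on X" for T
    using that by (simp add: topologies_on_def)
  \<comment> \<open>With \<open>f\<close> and \<open>g\<close> arbitrary, the same two facts serve
    both coproducts, each of which is some \<open>lin_ext\<close>.\<close>
  have linear: "Vector_Spaces.linear scale scale (\<lambda>t. lin_ext f (L_map t))"
    "Vector_Spaces.linear scale scale (\<lambda>t. tensor_map L_map L_map (lin_ext g t))"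
    for f :: "'a set list \<Rightarrow> 'a set list \<times> 'a set list \<Rightarrow>\<^sub>0 'k"
      and g :: "'a topology \<Rightarrow> 'a topology \<times> 'a topology \<Rightarrow>\<^sub>0 'k"
    unfolding tensor_map_def by (rule linear_comp[OF lin_ext_linear] L_map_linear lin_ext_linear)+
  show "SC_Delta (L_map t) = tensor_map L_map L_map (T_Delta t)"
    using linear_eq_on_free_space[OF linear SC_Delta_L_map_basis[OF fin, unfolded SC_Delta_def T_Delta_def] t]
    unfolding SC_Delta_def T_Delta_def .
  show "SC_rho (L_map t) = tensor_map L_map L_map (T_Gamma t)"
    using linear_eq_on_free_space[OF linear SC_rho_L_map_basis[OF fin, unfolded SC_rho_def T_Gamma_def] t]
    unfolding SC_rho_def T_Gamma_def .
qed (simp_all add: L_map_T_mult L_map_image_T_space)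

end
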